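(* Let $\beta\in[1,\infty)$ and let $\phi$ be a state of $\mathcal{T}(\mathrm{P}\rtimes\mathbb{N}^{\times})$. Suppose that for all $a,b\in\mathbb{N}^{\times}$, all $m,n\in\mathrm{P}$ and all $x_1,x_2,y_1,y_2\in\mathbb{N}$ with $m=2x_1+3y_1$, $n=2x_2+3y_2$: (i) if $a\neq b$ or $m\not\equiv n \pmod a$, then $\phi(s^{x_1}t^{y_1}\upsilon_a\upsilon_b^{*}t^{*y_2}s^{*x_2})=0$; (ii) if $a=b$ and $m\equiv n\pmod a$, then for some $u\in\mathbb{Z}$ such that $a$ divides both $y_1-y_2+2u$ and $x_1-x_2-3u$, $$\phi(s^{x_1}t^{y_1}\upsilon_a\upsilon_b^{*}t^{*y_2}s^{*x_2})=a^{-\beta}\,\phi\Big(t^{((\frac{y_1-y_2+2u}{a}))}\,s^{((\frac{x_1-x_2-3u}{a}))}\Big).$$ Then $\phi$ is a $\mathrm{KMS}_\beta$ state for $\sigma$.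
   Context: $\mathbb{N}=\{0,1,2,\dots\}$, $\mathbb{N}^{\times}$ is the multiplicative semigroup of positive integers, and $\mathrm{P}=\{0,2,3,4,\dots\}$ is an additive semigroup. $\mathrm{P}\rtimes\mathbb{N}^{\times}$ is the semigroup of pairs $(m,a)$, $m\in \mathrm{P}$, $a\in\mathbb{N}^\times$, with product $(m,a)(n,b)=(m+an,ab)$ and unit $(0,1)$. For $(m,a),(n,b)\in\mathrm{P}\rtimes\mathbb{N}^{\times}$ put $(m,a)\Cup(n,b)=\infty$ if $(m+a\mathrm{P})\cap(n+b\mathrm{P})=\emptyset$, and otherwise $(m,a)\Cup(n,b)=(\ell,\mathrm{lcm}(a,b))$, where $\ell$ is the smallest element (usual order) of $(m+a\mathrm{P})\cap(n+b\mathrm{P})$. An isometric representation $W$ of $\mathrm{P}\rtimes\mathbb{N}^{\times}$ is a map into the isometries (on a Hilbert space, or in a unital $C^*$-algebra) with $W_{(0,1)}=1$ and $W_{xy}=W_xW_y$. It is covariant if $W_{(m,a)}W_{(m,a)}^*W_{(n,b)}W_{(n,b)}^*=W_{(m,a)\Cup(n,b)}W_{(m,a)\Cup(n,b)}^*$ for all $(m,a),(n,b)$, with the convention $W_\infty=0$. $\mathcal{T}(\mathrm{P}\rtimes\mathbb{N}^{\times})$ is the $C^*$-algebra generated by a covariant isometric representation $W:\mathrm{P}\rtimes\mathbb{N}^\times\to\mathcal{T}(\mathrm{P}\rtimes\mathbb{N}^{\times})$ (the canonical one) that is universal: for every covariant isometric representation $X$ there is a homomorphism $\pi:\mathcal{T}(\mathrm{P}\rtimes\mathbb{N}^{\times})\to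 C^*(\{X_{(m,a)}\})$ with $\pi(W_{(m,a)})=X_{(m,a)}$. Write $s=W_{(2,1)}$, $t=W_{(3,1)}$, $\upsilon_a=W_{(0,a)}$ for $a\in\mathbb{N}^\times$ (so $\upsilon_a$ is the product of the $\upsilon_p$ over the prime factorization of $a$). For an isometry $w$ and $k\in\mathbb{Z}$, $w^{((k))}$ denotes $w^k$ if $k\ge 0$ and $(w^{*})^{-k}$ if $k<0$. $\sigma$ is the strongly continuous action of $\mathbb{R}$ on $\mathcal{T}(\mathrm{P}\rtimes\mathbb{N}^{\times})$ with $\sigma_r(s)=s$, $\sigma_r(t)=t$, $\sigma_r(\upsilon_p)=p^{ir}\upsilon_p$ for $p$ prime and $r\in\mathbb{R}$. An element $c$ is analytic for $\sigma$ if $r\mapsto\sigma_r(c)$ is the restriction to $\mathbb{R}$ of an entire function on $\mathbb{C}$, written $z\mapsto\sigma_z(c)$. For $\beta\in(0,\infty)$, a state $\phi$ is a $\mathrm{KMS}_\beta$ state for $\sigma$ if $\phi(cd)=\phi(d\,\sigma_{i\beta}(c))$ for all analytic elements $c,d$. *)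

theory Defs
  imports "HOL-Analysis.Analysis" "HOL-Number_Theory.Cong" "HOL-Algebra.Ring"
begin

section \<open>Unital \<open>C\<^sup>*\<close>-algebras\<close>

text \<open>
  Unital \<open>C\<^sup>*\<close>-algebras appear in two guises: as a type class, used for the algebra under study,
  and as structures with a carrier set, needed to quantify over all target algebras in a
  universal property. The notions of representation, generation and homomorphism are defined
  once, for structures; the structure of a type in the class is \<open>UNIV_cstar\<close> below.
\<close>

class cstar_algebra = real_normed_algebra_1 + banach +
  fixes scaleC :: "complex \<Rightarrow> 'a \<Rightarrow> 'a" (infixr "*\<^sub>C" 75)
    and star :: "'a \<Rightarrow> 'a"
  assumes scaleC_add_right: "c *\<^sub>C (x + y) = c *\<^sub>C x + c *\<^sub>C y"
    and scaleC_add_left: "(c + d) *\<^sub>C x = c *\<^sub>C x + d *\<^sub>C x"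
    and scaleC_scaleC: "c *\<^sub>C (d *\<^sub>C x) = (c * d) *\<^sub>C x"
    and scaleC_of_real: "complex_of_real r *\<^sub>C x = r *\<^sub>R x"
    and mult_scaleC_left: "(c *\<^sub>C x) * y = c *\<^sub>C (x * y)"
    and mult_scaleC_right: "x * (c *\<^sub>C y) = c *\<^sub>C (x * y)"
    and norm_scaleC: "norm (c *\<^sub>C x) = cmod c * norm x"
    and star_star: "star (star x) = x"
    and star_add: "star (x + y) = star x + star y"
    and star_scaleC: "star (c *\<^sub>C x) = cnj c *\<^sub>C star x"
    and star_mult: "star (x * y) = star y * star x"
    and norm_star_mult: "norm (star x * x) = (norm x)\<^sup>2"

record 'b cstar_struct = "'b ring" +
  smulC :: "complex \<Rightarrow> 'b \<Rightarrow> 'b"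
  invol :: "'b \<Rightarrow> 'b"
  nrm :: "'b \<Rightarrow> real"

locale cstar_structure = ring B for B :: "'b cstar_struct" (structure) +
  assumes smulC_closed: "x \<in> carrier B \<Longrightarrow> smulC B c x \<in> carrier B"
    and smulC_add_right: "\<lbrakk>x \<in> carrier B; y \<in> carrier B\<rbrakk> \<Longrightarrow>
          smulC B c (x \<oplus> y) = smulC B c x \<oplus> smulC B c y"
    and smulC_add_left: "x \<in> carrier B \<Longrightarrow> smulC B (c + d) x = smulC B c x \<oplus> smulC B d x"
    and smulC_smulC: "x \<in> carrier B \<Longrightarrow> smulC B c (smulC B d x) = smulC B (c * d) x"
    and smulC_one: "x \<in> carrier B \<Longrightarrow> smulC B 1 x = x"
    and mult_smulC_left: "\<lbrakk>x \<in> carrier B; y \<in> carrier B\<rbrakk> \<Longrightarrow>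
          smulC B c x \<otimes> y = smulC B c (x \<otimes> y)"
    and mult_smulC_right: "\<lbrakk>x \<in> carrier B; y \<in> carrier B\<rbrakk> \<Longrightarrow>
          x \<otimes> smulC B c y = smulC B c (x \<otimes> y)"
    and invol_closed: "x \<in> carrier B \<Longrightarrow> invol B x \<in> carrier B"
    and invol_invol: "x \<in> carrier B \<Longrightarrow> invol B (invol B x) = x"
    and invol_add: "\<lbrakk>x \<in> carrier B; y \<in> carrier B\<rbrakk> \<Longrightarrow>
          invol B (x \<oplus> y) = invol B x \<oplus> invol B y"
    and invol_smulC: "x \<in> carrier B \<Longrightarrow> invol B (smulC B c x) = smulC B (cnj c) (invol B x)"
    and invol_mult: "\<lbrakk>x \<in> carrier B; y \<in> carrier B\<rbrakk> \<Longrightarrow>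
          invol B (x \<otimes> y) = invol B y \<otimes> invol B x"
    and nrm_nonneg: "x \<in> carrier B \<Longrightarrow> 0 \<le> nrm B x"
    and nrm_eq_0_iff: "x \<in> carrier B \<Longrightarrow> nrm B x = 0 \<longleftrightarrow> x = \<zero>"
    and nrm_triangle: "\<lbrakk>x \<in> carrier B; y \<in> carrier B\<rbrakk> \<Longrightarrow> nrm B (x \<oplus> y) \<le> nrm B x + nrm B y"
    and nrm_smulC: "x \<in> carrier B \<Longrightarrow> nrm B (smulC B c x) = cmod c * nrm B x"
    and nrm_mult: "\<lbrakk>x \<in> carrier B; y \<in> carrier B\<rbrakk> \<Longrightarrow> nrm B (x \<otimes> y) \<le> nrm B x * nrm B y"
    and nrm_invol_mult: "x \<in> carrier B \<Longrightarrow> nrm B (invol B x \<otimes> x) = (nrm B x)\<^sup>2"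
    and complete: "\<lbrakk>range (f :: nat \<Rightarrow> 'b) \<subseteq> carrier B;
          \<forall>e>0. \<exists>N. \<forall>m\<ge>N. \<forall>n\<ge>N. nrm B (f m \<ominus> f n) < e\<rbrakk> \<Longrightarrow>
          \<exists>l\<in>carrier B. \<forall>e>0. \<exists>N. \<forall>n\<ge>N. nrm B (f n \<ominus> l) < e"

definition UNIV_cstar :: "'a::cstar_algebra cstar_struct" where
  "UNIV_cstar = \<lparr>carrier = UNIV, mult = (*), one = 1, zero = 0, add = (+),
     smulC = scaleC, invol = star, nrm = norm\<rparr>"

lemma UNIV_cstar_simps [simp]:
  "carrier UNIV_cstar = UNIV" "mult UNIV_cstar = (*)" "one UNIV_cstar = 1"
  "zero UNIV_cstar = 0" "add UNIV_cstar = (+)" "smulC UNIV_cstar = scaleC"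
  "invol UNIV_cstar = star" "nrm UNIV_cstar = norm"
  by (simp_all add: UNIV_cstar_def)

lemma ring_UNIV_cstar: "ring (UNIV_cstar :: 'a::cstar_algebra cstar_struct)"
proof (rule ringI)
  show "abelian_group (UNIV_cstar :: 'a cstar_struct)"
  proof (rule abelian_groupI)
    fix x :: 'a
    show "\<exists>y\<in>carrier UNIV_cstar. y \<oplus>\<^bsub>UNIV_cstar\<^esub> x = \<zero>\<^bsub>UNIV_cstar\<^esub>"
      by (auto intro: exI[of _ "- x"])
  qed (auto simp: algebra_simps)
  show "Group.monoid (UNIV_cstar :: 'a cstar_struct)"
    by (rule monoidI) (auto simp: algebra_simps)
qed (auto simp: algebra_simps)

lemma a_minus_UNIV_cstar [simp]: "x \<ominus>\<^bsub>UNIV_cstar\<^esub> y = x - y"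
proof -
  interpret U: ring "UNIV_cstar :: 'a cstar_struct" by (rule ring_UNIV_cstar)
  have "\<ominus>\<^bsub>UNIV_cstar\<^esub> y = - y"
    by (rule U.minus_equality) auto
  then show ?thesis by (simp add: a_minus_def)
qed

lemma cstar_structure_UNIV: "cstar_structure (UNIV_cstar :: 'a::cstar_algebra cstar_struct)"
proof -
  have "convergent f"
    if "\<forall>e>0. \<exists>N. \<forall>m\<ge>N. \<forall>n\<ge>N. norm (f m - f n) < e" for f :: "nat \<Rightarrow> 'a"
    using that by (simp add: Cauchy_convergent_iff [symmetric] Cauchy_iff)
  moreover have "1 *\<^sub>C x = x" for x :: 'a
    using scaleC_of_real[of 1 x] by simp
  ultimately show ?thesis
    by (intro cstar_structure.intro ring_UNIV_cstar cstar_structure_axioms.intro)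
      (auto simp: scaleC_add_right scaleC_add_left scaleC_scaleC mult_scaleC_left
        mult_scaleC_right norm_scaleC star_star star_add star_scaleC star_mult norm_star_mult
        norm_triangle_ineq norm_mult_ineq convergent_def LIMSEQ_iff)
qed

definition sub_cstar :: "'b cstar_struct \<Rightarrow> 'b set \<Rightarrow> bool" where
  "sub_cstar B D \<longleftrightarrow> D \<subseteq> carrier B \<and> \<zero>\<^bsub>B\<^esub> \<in> D \<and>
     (\<forall>x\<in>D. \<forall>y\<in>D. x \<oplus>\<^bsub>B\<^esub> y \<in> D \<and> x \<otimes>\<^bsub>B\<^esub> y \<in> D) \<and>
     (\<forall>c. \<forall>x\<in>D. smulC B c x \<in> D) \<and> (\<forall>x\<in>D. invol B x \<in> D) \<and>
     (\<forall>x\<in>carrier B. (\<forall>e>0. \<exists>y\<in>D. nrm B (x \<ominus>\<^bsub>B\<^esub> y) < e) \<longrightarrow> x \<in> D)"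

definition cstar_generated :: "'b cstar_struct \<Rightarrow> 'b set \<Rightarrow> 'b set" where
  "cstar_generated B S = \<Inter>{D. sub_cstar B D \<and> S \<subseteq> D}"

definition star_hom :: "'a cstar_struct \<Rightarrow> 'b cstar_struct \<Rightarrow> ('a \<Rightarrow> 'b) \<Rightarrow> bool" where
  "star_hom A B \<pi> \<longleftrightarrow> \<pi> \<in> carrier A \<rightarrow> carrier B \<and>
     (\<forall>x\<in>carrier A. \<forall>y\<in>carrier A.
        \<pi> (x \<oplus>\<^bsub>A\<^esub> y) = \<pi> x \<oplus>\<^bsub>B\<^esub> \<pi> y \<and> \<pi> (x \<otimes>\<^bsub>A\<^esub> y) = \<pi> x \<otimes>\<^bsub>B\<^esub> \<pi> y) \<and>
     (\<forall>c. \<forall>x\<in>carrier A. \<pi> (smulC A c x) = smulC B c (\<pi> x)) \<and>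
     (\<forall>x\<in>carrier A. \<pi> (invol A x) = invol B (\<pi> x))"

section \<open>The semigroup and its covariant isometric representations\<close>

definition semiP :: "nat set" where
  "semiP = {n. n \<noteq> 1}"

definition PN :: "(nat \<times> nat) set" where
  "PN = semiP \<times> {a. 0 < a}"

fun pn_mult :: "nat \<times> nat \<Rightarrow> nat \<times> nat \<Rightarrow> nat \<times> nat" where
  "pn_mult (m, a) (n, b) = (m + a * n, a * b)"

definition P_coset :: "nat \<Rightarrow> nat \<Rightarrow> nat set" where
  "P_coset m a = (\<lambda>k. m + a * k) ` semiP"

text \<open>\<open>None\<close> plays the role of \<open>\<infinity>\<close>.\<close>

fun pn_cup :: "nat \<times> nat \<Rightarrow> nat \<times> nat \<Rightarrow> (nat \<times> nat) option" where
  "pn_cup (m, a) (n, b) =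
     (if P_coset m a \<inter> P_coset n b = {} then None
      else Some (LEAST l. l \<in> P_coset m a \<inter> P_coset n b, lcm a b))"

text \<open>Representations are functions on all pairs of naturals; only their values on \<open>PN\<close> matter.\<close>

definition isometric_rep :: "'b cstar_struct \<Rightarrow> (nat \<times> nat \<Rightarrow> 'b) \<Rightarrow> bool" where
  "isometric_rep B X \<longleftrightarrow>
     (\<forall>x\<in>PN. X x \<in> carrier B \<and> invol B (X x) \<otimes>\<^bsub>B\<^esub> X x = \<one>\<^bsub>B\<^esub>) \<and>
     X (0, 1) = \<one>\<^bsub>B\<^esub> \<and>
     (\<forall>x\<in>PN. \<forall>y\<in>PN. X (pn_mult x y) = X x \<otimes>\<^bsub>B\<^esub> X y)"

fun range_proj :: "'b cstar_struct \<Rightarrow> (nat \<times> nat \<Rightarrow> 'b) \<Rightarrow> (nat \<times> nat) option \<Rightarrow> 'b" where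
  "range_proj B X None = \<zero>\<^bsub>B\<^esub>"
| "range_proj B X (Some x) = X x \<otimes>\<^bsub>B\<^esub> invol B (X x)"

definition covariant_isometric_rep :: "'b cstar_struct \<Rightarrow> (nat \<times> nat \<Rightarrow> 'b) \<Rightarrow> bool" where
  "covariant_isometric_rep B X \<longleftrightarrow> isometric_rep B X \<and>
     (\<forall>x\<in>PN. \<forall>y\<in>PN. range_proj B X (Some x) \<otimes>\<^bsub>B\<^esub> range_proj B X (Some y)
        = range_proj B X (pn_cup x y))"

text \<open>
  The type \<open>'a\<close>, together with \<open>W\<close>, is the \<open>C\<^sup>*\<close>-algebra \<open>\<T>(P \<rtimes> \<nat>\<^sup>\<times>)\<close> with its canonical
  representation. The target algebras have carriers in \<open>real\<close>. This is no restriction: \<open>PN\<close> is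
  countable, so the algebra generated by a representation \<open>X\<close> is separable, has at most continuum
  many elements, and hence is isomorphic to a structure whose carrier is a set of reals.
\<close>

definition universal_covariant_rep :: "(nat \<times> nat \<Rightarrow> 'a::cstar_algebra) \<Rightarrow> bool" where
  "universal_covariant_rep W \<longleftrightarrow>
     covariant_isometric_rep UNIV_cstar W \<and>
     cstar_generated UNIV_cstar (W ` PN) = UNIV \<and>
     (\<forall>(B :: real cstar_struct) X. cstar_structure B \<and> covariant_isometric_rep B X \<longrightarrow>
        (\<exists>\<pi>. star_hom UNIV_cstar (B\<lparr>carrier := cstar_generated B (X ` PN)\<rparr>) \<pi> \<and>
             (\<forall>x\<in>PN. \<pi> (W x) = X x)))"

abbreviation gen_s :: "(nat \<times> nat \<Rightarrow> 'a) \<Rightarrow> 'a" where "gen_s W \<equiv> W (2, 1)"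
abbreviation gen_t :: "(nat \<times> nat \<Rightarrow> 'a) \<Rightarrow> 'a" where "gen_t W \<equiv> W (3, 1)"
abbreviation gen_v :: "(nat \<times> nat \<Rightarrow> 'a) \<Rightarrow> nat \<Rightarrow> 'a" where "gen_v W a \<equiv> W (0, a)"

definition signed_power :: "'a::cstar_algebra \<Rightarrow> int \<Rightarrow> 'a" where
  "signed_power w k = (if 0 \<le> k then w ^ nat k else star w ^ nat (- k))"

section \<open>Dynamics and KMS states\<close>

definition strongly_continuous_action :: "(real \<Rightarrow> 'a::cstar_algebra \<Rightarrow> 'a) \<Rightarrow> bool" where
  "strongly_continuous_action \<sigma> \<longleftrightarrow>
     (\<forall>r. bij (\<sigma> r) \<and> star_hom UNIV_cstar UNIV_cstar (\<sigma> r)) \<and>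
     \<sigma> 0 = id \<and> (\<forall>q r. \<sigma> (q + r) = \<sigma> q \<circ> \<sigma> r) \<and>
     (\<forall>c. continuous_on UNIV (\<lambda>r. \<sigma> r c))"

definition dynamics :: "(nat \<times> nat \<Rightarrow> 'a::cstar_algebra) \<Rightarrow> (real \<Rightarrow> 'a \<Rightarrow> 'a) \<Rightarrow> bool" where
  "dynamics W \<sigma> \<longleftrightarrow> strongly_continuous_action \<sigma> \<and>
     (\<forall>r. \<sigma> r (gen_s W) = gen_s W \<and> \<sigma> r (gen_t W) = gen_t W \<and>
        (\<forall>p::nat. prime p \<longrightarrow>
           \<sigma> r (gen_v W p) = (of_nat p powr (\<i> * complex_of_real r)) *\<^sub>C gen_v W p))"

definition entire :: "(complex \<Rightarrow> 'a::cstar_algebra) \<Rightarrow> bool" where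
  "entire F \<longleftrightarrow> (\<forall>z. \<exists>D. ((\<lambda>h. inverse h *\<^sub>C (F (z + h) - F z)) \<longlongrightarrow> D) (at 0))"

text \<open>\<open>F\<close> is the entire extension \<open>z \<mapsto> \<sigma>\<^sub>z(c)\<close>; it is unique by the identity theorem.\<close>

definition analytic_extension ::
    "(real \<Rightarrow> 'a::cstar_algebra \<Rightarrow> 'a) \<Rightarrow> 'a \<Rightarrow> (complex \<Rightarrow> 'a) \<Rightarrow> bool" where
  "analytic_extension \<sigma> c F \<longleftrightarrow> entire F \<and> (\<forall>r. F (complex_of_real r) = \<sigma> r c)"

definition analytic_element :: "(real \<Rightarrow> 'a::cstar_algebra \<Rightarrow> 'a) \<Rightarrow> 'a \<Rightarrow> bool" where
  "analytic_element \<sigma> c \<longleftrightarrow> (\<exists>F. analytic_extension \<sigma> c F)"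

text \<open>A state is a positive linear functional of norm one.\<close>

definition state :: "('a::cstar_algebra \<Rightarrow> complex) \<Rightarrow> bool" where
  "state \<phi> \<longleftrightarrow> bounded_linear \<phi> \<and> (\<forall>c x. \<phi> (c *\<^sub>C x) = c * \<phi> x) \<and>
     (\<forall>x. \<phi> (star x * x) \<in> \<real>\<^sub>\<ge>\<^sub>0) \<and> onorm \<phi> = 1"

definition KMS_state ::
    "(real \<Rightarrow> 'a::cstar_algebra \<Rightarrow> 'a) \<Rightarrow> real \<Rightarrow> ('a \<Rightarrow> complex) \<Rightarrow> bool" where
  "KMS_state \<sigma> \<beta> \<phi> \<longleftrightarrow> state \<phi> \<and>
     (\<forall>c d F. analytic_extension \<sigma> c F \<and> analytic_element \<sigma> d \<longrightarrow>
        \<phi> (c * d) = \<phi> (d * F (\<i> * complex_of_real \<beta>)))"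

end

theory Submission
  imports Defs "HOL-Complex_Analysis.Conformal_Mappings"
begin

text \<open>
  Covariance at the pair \<open>(2, 1), (3, 1)\<close> makes \<open>s\<^sup>*\<close> commute with \<open>t\<close>. Together with \<open>s\<^sup>3 = t\<^sup>2\<close> this
  forces \<open>s\<close> and \<open>t\<close> to be unitary (\<open>s_unitary\<close>, \<open>t_unitary\<close>), so the gap in the semigroup
  disappears: the unitary \<open>u = s\<^sup>* t\<close> satisfies \<open>s = u\<^sup>2\<close>, \<open>t = u\<^sup>3\<close> and \<open>v\<^sub>a u = u\<^sup>a v\<^sub>a\<close>. The monomials
  \<open>u\<^sup>j v\<^sub>a v\<^sub>b\<^sup>* u\<^sup>k\<close> with integer \<open>j, k\<close> span a dense subalgebra (\<open>eq_if_eq_on_monomials\<close>), and the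
  two hypotheses on the state say that it vanishes on such a monomial unless \<open>a = b\<close> divides
  \<open>j + k\<close>, when its value is \<open>a\<close> to the power \<open>-\<beta>\<close> times its value at the power of \<open>u\<close> with
  exponent \<open>(j + k) / a\<close>.

  For a fixed right factor \<open>d\<close>, the relation \<open>\<phi> (x d) = \<lambda>\<^sup>\<beta> \<phi> (d x)\<close> for all \<open>x\<close> passes to products
  and adjoints of such \<open>d\<close>, the scalars \<open>\<lambda>\<close> being multiplied and inverted. So it has to be checked
  only for \<open>d = u\<^sup>n\<close> with \<open>\<lambda> = 1\<close>, where it holds because the value above depends on \<open>j + k\<close> alone,
  and for \<open>d = v\<^sub>c\<close> with \<open>\<lambda> = c\<close>, where the essential case is \<open>b = c a\<close>: there \<open>v\<^sub>c\<^sup>* u\<^sup>k v\<^sub>c\<close> is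
  \<open>u\<close> to the power \<open>k / c\<close>, or \<open>0\<close> when \<open>c\<close> does not divide \<open>k\<close> (\<open>twisted_V\<close>).

  This settles the KMS condition against a monomial \<open>d\<close> formally; to reach an arbitrary analytic
  left factor \<open>c\<close>, one compares the entire function \<open>z \<mapsto> \<phi> (d \<sigma>\<^sub>z(c))\<close> with an explicit exponential.
  They agree on the real line because \<open>\<phi>\<close> is \<open>\<sigma>\<close>-invariant, hence everywhere, and the value at
  \<open>i\<beta>\<close> is the KMS condition (\<open>KMS_monomial\<close>). The right factor is then extended by linearity and
  continuity. Invariance is clear on monomials; to extend it one needs that \<open>\<phi> \<circ> \<sigma>\<^sub>r\<close> is bounded,
  which follows from its positivity (\<open>positive_functional_bounded\<close>).
\<close>

section \<open>Unital \<open>C\<^sup>*\<close>-algebras and their positive functionals\<close>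

lemma scaleC_0_left [simp]: "0 *\<^sub>C (x::'a::cstar_algebra) = 0"
  using scaleC_of_real[of 0 x] by simp

lemma scaleC_1 [simp]: "1 *\<^sub>C (x::'a::cstar_algebra) = x"
  using scaleC_of_real[of 1 x] by simp

lemma scaleC_minus_one: "(-1) *\<^sub>C (x::'a::cstar_algebra) = - x"
  using scaleC_of_real[of "-1" x] by simp

lemma star_one [simp]: "star (1::'a::cstar_algebra) = 1"
  by (metis mult_1_right star_mult star_star)

lemma norm_star [simp]: "norm (star x) = norm (x::'a::cstar_algebra)"
proof -
  have le: "norm y \<le> norm (star y)" for y :: 'a
  proof (cases "y = 0")
    case False
    have "norm y * norm y \<le> norm (star y) * norm y"
      using norm_star_mult[of y] norm_mult_ineq[of "star y" y] by (simp add: power2_eq_square)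
    then show ?thesis using False by simp
  qed simp
  show ?thesis using le[of x] le[of "star x"] by (simp add: star_star)
qed

lemma bounded_linear_star: "bounded_linear (star :: 'a::cstar_algebra \<Rightarrow> 'a)"
proof (rule bounded_linear_intro[where K = 1])
  fix r and x :: 'a
  show "star (r *\<^sub>R x) = r *\<^sub>R star x"
    by (metis scaleC_of_real star_scaleC complex_cnj_complex_of_real)
qed (auto simp: star_add)

lemmas star_zero [simp] = bounded_linear.linear[OF bounded_linear_star, THEN linear_0]
lemmas star_diff = bounded_linear.linear[OF bounded_linear_star, THEN linear_diff]

lemma star_power: "star (x ^ n) = star (x::'a::cstar_algebra) ^ n"
  by (induction n) (auto simp: star_mult power_commutes)

lemma bounded_linear_scaleC: "bounded_linear (scaleC c :: 'a::cstar_algebra \<Rightarrow> 'a)"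
proof (rule bounded_linear_intro[where K = "cmod c"])
  fix r and x :: 'a
  show "c *\<^sub>C (r *\<^sub>R x) = r *\<^sub>R (c *\<^sub>C x)"
    by (metis scaleC_of_real scaleC_scaleC mult.commute)
qed (auto simp: scaleC_add_right norm_scaleC mult.commute)

text \<open>
  The equation \<open>(1 - z)\<^sup>2 = 1 - h\<close> says that \<open>z\<close> is a fixed point of \<open>z \<mapsto> (h + z\<^sup>2) / 2\<close>, which maps the
  self-adjoint elements of norm at most \<open>1/2\<close> to themselves and is a contraction there.
\<close>

lemma selfadjoint_sqrt:
  fixes h :: "'a::cstar_algebra"
  assumes h: "star h = h" and n: "norm h \<le> 3/4"
  shows "\<exists>y. star y = y \<and> y * y = 1 - h"
proof -
  let ?S = "{z::'a. star z = z} \<inter> cball 0 (1/2)"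
  let ?f = "\<lambda>z. (1/2) *\<^sub>R (h + z * z)"
  have S: "complete ?S"
    unfolding complete_eq_closed
    by (intro closed_Int closed_cball closed_Collect_eq continuous_intros
        bounded_linear.continuous_on[OF bounded_linear_star])
  have nz: "norm (z * z) \<le> 1/4" if "norm z \<le> 1/2" for z :: 'a
  proof -
    have "norm (z * z) \<le> norm z * norm z" by (rule norm_mult_ineq)
    also have "\<dots> \<le> 1/2 * (1/2)" using that by (intro mult_mono) auto
    finally show ?thesis by simp
  qed
  have maps: "?f ` ?S \<subseteq> ?S"
  proof safe
    fix z :: 'a assume z: "star z = z" "z \<in> cball 0 (1/2)"
    show "star (?f z) = ?f z"
      using z h by (simp add: linear_cmul[OF bounded_linear.linear[OF bounded_linear_star]]
          star_add star_mult)
    have "norm (h + z * z) \<le> 1"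
      using norm_triangle_ineq[of h "z * z"] nz[of z] n z by simp
    then show "?f z \<in> cball 0 (1/2)" by simp
  qed
  have contr: "\<forall>x\<in>?S. \<forall>y\<in>?S. dist (?f x) (?f y) \<le> 1/2 * dist x y"
  proof safe
    fix x y :: 'a assume x: "x \<in> cball 0 (1/2)" and y: "y \<in> cball 0 (1/2)"
    have "norm (x * x - y * y) = norm (x * (x - y) + (x - y) * y)"
      by (simp add: algebra_simps)
    also have "\<dots> \<le> norm x * norm (x - y) + norm (x - y) * norm y"
      by (meson norm_triangle_ineq order_trans add_mono norm_mult_ineq)
    also have "\<dots> \<le> 1/2 * norm (x - y) + norm (x - y) * (1/2)"
      using x y by (intro add_mono mult_mono) auto
    finally have "norm (x * x - y * y) \<le> norm (x - y)" by simp
    then show "dist (?f x) (?f y) \<le> 1/2 * dist x y"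
      by (simp add: dist_norm scaleR_diff_right[symmetric])
  qed
  have "0 \<in> ?S" by simp
  then have "?S \<noteq> {}" by blast
  then have "\<exists>!z\<in>?S. ?f z = z"
    by (rule Banach_fix[OF S _ _ _ maps, where c = "1/2"]) (use contr in auto)
  then obtain z where z: "z \<in> ?S" "?f z = z" by auto
  have "2 *\<^sub>R z = h + z * z" by (subst z(2)[symmetric]) simp
  then have "(1 - z) * (1 - z) = 1 - h"
    by (simp add: algebra_simps scaleR_2)
  then show ?thesis using z(1) by (intro exI[of _ "1 - z"]) (auto simp: star_diff)
qed

text \<open>
  Boundedness comes from the order: for a self-adjoint \<open>h\<close> of norm at most \<open>3/4\<close> both \<open>1 - h\<close> and
  \<open>1 + h\<close> are squares of self-adjoint elements, so the value at \<open>h\<close> is trapped between minus and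
  plus the value at \<open>1\<close>.
\<close>

lemma positive_functional_bounded:
  fixes \<psi> :: "'a::cstar_algebra \<Rightarrow> complex"
  assumes add: "\<And>x y. \<psi> (x + y) = \<psi> x + \<psi> y"
    and scale: "\<And>c x. \<psi> (c *\<^sub>C x) = c * \<psi> x"
    and pos: "\<And>x. \<psi> (star x * x) \<in> \<real>\<^sub>\<ge>\<^sub>0"
  shows "bounded_linear \<psi>"
proof -
  have scR: "\<psi> (r *\<^sub>R x) = r *\<^sub>R \<psi> x" for r x
    using scale[of "of_real r" x] by (simp add: scaleC_of_real scaleR_conv_of_real)
  have diff: "\<psi> (x - y) = \<psi> x - \<psi> y" for x y
    using add[of "x - y" y] by simp
  have minus: "\<psi> (- x) = - \<psi> x" for x
    using scR[of "-1" x] by simp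
  define M where "M = cmod (\<psi> 1)"
  have small: "cmod (\<psi> h) \<le> M" if h: "star h = h" "norm h \<le> 3/4" for h
  proof -
    have *: "Im (\<psi> k) = Im (\<psi> 1) \<and> Re (\<psi> k) \<le> Re (\<psi> 1)" if k: "star k = k" "norm k \<le> 3/4" for k
    proof -
      obtain y where "star y = y" "y * y = 1 - k" using selfadjoint_sqrt[OF k] by blast
      then have "\<psi> (1 - k) \<in> \<real>\<^sub>\<ge>\<^sub>0" using pos[of y] by simp
      then show ?thesis by (simp add: diff complex_nonneg_Reals_iff)
    qed
    have one: "Im (\<psi> 1) = 0" using pos[of 1] by (simp add: complex_nonneg_Reals_iff)
    have "star (- h) = - h" using h(1) star_diff[of 0 h] by simp
    then have "Re (\<psi> (- h)) \<le> Re (\<psi> 1)" using * h by simp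
    then have "\<bar>Re (\<psi> h)\<bar> \<le> Re (\<psi> 1)" using *[OF h] by (simp add: minus abs_le_iff)
    then show ?thesis
      using *[OF h] one by (simp add: M_def cmod_eq_Re)
  qed
  have sa: "cmod (\<psi> h) \<le> 4/3 * M * norm h" if h: "star h = h" for h
  proof (cases "h = 0")
    case True then show ?thesis using scale[of 0 0] by simp
  next
    case False
    \<comment> \<open>the scaling that brings \<open>h\<close> to norm \<open>3/4\<close>\<close>
    define r where "r = 3 / (4 * norm h)"
    have r: "r > 0" using False by (simp add: r_def)
    have "cmod (\<psi> (r *\<^sub>R h)) \<le> M"
      using h False r linear_cmul[OF bounded_linear.linear[OF bounded_linear_star], of r h]
      by (intro small) (auto simp: r_def)
    then have "r * cmod (\<psi> h) \<le> M" using r by (simp add: scR)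
    then show ?thesis using False by (simp add: r_def field_simps)
  qed
  show ?thesis
  proof (rule bounded_linear_intro[where K = "8/3 * M"])
    fix x :: 'a
    let ?a = "x + star x" and ?b = "\<i> *\<^sub>C (x - star x)"
    have M0: "0 \<le> M" by (simp add: M_def)
    have a: "cmod (\<psi> ?a) \<le> 4/3 * M * (norm x + norm x)"
    proof -
      have "cmod (\<psi> ?a) \<le> 4/3 * M * norm ?a"
        by (rule sa) (simp add: star_add star_star add.commute)
      also have "\<dots> \<le> 4/3 * M * (norm x + norm x)"
        using norm_triangle_ineq[of x "star x"] M0 by (intro mult_left_mono) auto
      finally show ?thesis .
    qed
    have "star ?b = (- \<i>) *\<^sub>C (star x - x)" by (simp add: star_scaleC star_diff star_star)
    also have "star x - x = (-1) *\<^sub>C (x - star x)" by (simp only: scaleC_minus_one minus_diff_eq)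
    finally have "star ?b = ?b" by (simp add: scaleC_scaleC)
    then have "cmod (\<psi> ?b) \<le> 4/3 * M * norm (x - star x)"
      using sa[of ?b] by (simp add: norm_scaleC)
    also have "\<dots> \<le> 4/3 * M * (norm x + norm x)"
      using norm_triangle_ineq4[of x "star x"] M0 by (intro mult_left_mono) auto
    finally have b: "cmod (\<psi> (x - star x)) \<le> 4/3 * M * (norm x + norm x)"
      by (simp add: scale norm_mult)
    have "2 *\<^sub>R x = ?a + (x - star x)" by (simp add: scaleR_2)
    then have "2 *\<^sub>R \<psi> x = \<psi> ?a + \<psi> (x - star x)" by (metis scR add)
    then have "2 * cmod (\<psi> x) = cmod (\<psi> ?a + \<psi> (x - star x))"
      by (metis norm_scaleR abs_numeral)
    then show "cmod (\<psi> x) \<le> norm x * (8/3 * M)"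
      using a b norm_triangle_ineq[of "\<psi> ?a" "\<psi> (x - star x)"] by (simp add: algebra_simps)
  qed (auto simp: add scR)
qed

text \<open>
  Positivity at \<open>1 + y\<close> makes the sum of the values at \<open>y\<close> and \<open>star y\<close> real. Taking \<open>y = x\<close> compares
  the imaginary parts, taking \<open>y = \<i> x\<close> the real parts.
\<close>

lemma positive_functional_star:
  fixes \<psi> :: "'a::cstar_algebra \<Rightarrow> complex"
  assumes add: "\<And>x y. \<psi> (x + y) = \<psi> x + \<psi> y"
    and scale: "\<And>c x. \<psi> (c *\<^sub>C x) = c * \<psi> x"
    and pos: "\<And>x. \<psi> (star x * x) \<in> \<real>\<^sub>\<ge>\<^sub>0"
  shows "\<psi> (star x) = cnj (\<psi> x)"
proof -
  have re: "Im (\<psi> (star y * y)) = 0" for y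
    using pos[of y] by (simp add: complex_nonneg_Reals_iff)
  have *: "Im (\<psi> y) + Im (\<psi> (star y)) = 0" for y
    using re[of "1 + y"] re[of 1] re[of y] by (simp add: star_add algebra_simps add)
  show ?thesis
    using *[of x] *[of "\<i> *\<^sub>C x"] by (simp add: complex_eq_iff star_scaleC scale)
qed

section \<open>Integer powers of a unitary\<close>

lemma signed_power_int [simp]: "signed_power w (int n) = w ^ n"
  by (simp add: signed_power_def)

lemma star_signed_power: "star (signed_power w k) = signed_power w (- k)"
  by (cases "k = 0") (auto simp: signed_power_def star_power star_star)

lemma signed_power_add:
  fixes w :: "'a::cstar_algebra"
  assumes w: "star w * w = 1" "w * star w = 1"
  shows "signed_power w (j + k) = signed_power w j * signed_power w k"
proof -
  have suc: "signed_power w (j + 1) = signed_power w j * w" for j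
  proof (cases "0 \<le> j")
    case True
    then show ?thesis by (simp add: signed_power_def nat_add_distrib power_commutes)
  next
    case False
    then obtain n where n: "j = - int (Suc n)" by (metis not_le_imp_less negD)
    have "signed_power w (j + 1) = star w ^ n"
      by (cases n) (auto simp: signed_power_def n nat_add_distrib)
    also have "\<dots> = signed_power w j * w"
    proof -
      have "signed_power w j = star w ^ n * star w"
        by (simp only: n signed_power_def) (simp add: nat_add_distrib power_commutes)
      then show ?thesis using w by (simp add: mult.assoc)
    qed
    finally show ?thesis .
  qed
  have pred: "signed_power w (j - 1) = signed_power w j * star w" for j
    using suc[of "j - 1"] w by (simp add: mult.assoc)
  show ?thesis
  proof (induction k rule: int_induct[where k = 0])
    case base then show ?case by (simp add: signed_power_def)
  next
    case (step1 i)
    then show ?case using suc[of "j + i"] suc[of i] by (simp add: mult.assoc add.assoc)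
  next
    case (step2 i)
    then show ?case using pred[of "j + i"] pred[of i] by (simp add: mult.assoc add_diff_eq)
  qed
qed

lemma signed_power_signed_power:
  fixes w :: "'a::cstar_algebra"
  assumes w: "star w * w = 1" "w * star w = 1"
  shows "signed_power (signed_power w j) k = signed_power w (j * k)"
proof -
  have nat: "signed_power w i ^ n = signed_power w (i * int n)" for i n
    by (induction n) (auto simp: signed_power_add[OF w, symmetric] algebra_simps,
        simp add: signed_power_def)
  show ?thesis
    by (cases "0 \<le> k") (auto simp: signed_power_def[of "signed_power w j"] nat star_signed_power)
qed

section \<open>Covariance makes the additive part unitary\<close>

lemma in_semiP [simp]: "n \<in> semiP \<longleftrightarrow> n \<noteq> 1"
  by (simp add: semiP_def)

lemma in_PN [simp]: "(m, a) \<in> PN \<longleftrightarrow> m \<noteq> 1 \<and> 0 < a"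
  by (simp add: PN_def)

lemma in_P_coset: "l \<in> P_coset m a \<longleftrightarrow> (\<exists>k. k \<noteq> 1 \<and> l = m + a * k)"
  by (auto simp: P_coset_def)

lemma pn_cup_2_3: "pn_cup (2, 1) (3, 1) = Some (5, 1)"
proof -
  have 5: "5 \<in> P_coset 2 1 \<inter> P_coset 3 1"
    by (auto simp: in_P_coset intro: exI[of _ 3] exI[of _ 2])
  have "(LEAST l. l \<in> P_coset 2 1 \<inter> P_coset 3 1) = 5"
  proof (rule Least_equality, rule 5)
    fix y assume "y \<in> P_coset 2 1 \<inter> P_coset 3 1"
    then obtain j k where "j \<noteq> 1" "k \<noteq> 1" "y = 2 + j" "y = 3 + k"
      by (auto simp: in_P_coset)
    then show "5 \<le> y" by linarith
  qed
  then show ?thesis using 5 by auto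
qed

lemma pn_cup_SomeD:
  assumes "pn_cup (m, a) (n, b) = Some z"
  obtains k l a' b' where "k \<noteq> 1" "l \<noteq> 1" "0 < a \<Longrightarrow> 0 < b \<Longrightarrow> 0 < a' \<and> 0 < b'"
    "z = (m + a * k, a * a')" "z = (n + b * l, b * b')"
proof -
  let ?I = "P_coset m a \<inter> P_coset n b"
  have ne: "?I \<noteq> {}" and z: "z = (LEAST l. l \<in> ?I, lcm a b)"
    using assms by (auto split: if_splits)
  have "fst z \<in> ?I"
    using ne LeastI_ex[of "\<lambda>l. l \<in> ?I"] z by auto
  then obtain k l where kl: "k \<noteq> 1" "fst z = m + a * k" "l \<noteq> 1" "fst z = n + b * l"
    by (auto simp: in_P_coset)
  obtain a' b' where ab: "lcm a b = a * a'" "lcm a b = b * b'"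
    by (meson dvdE dvd_lcm1 dvd_lcm2)
  show ?thesis
  proof (rule that[OF kl(1,3)])
    show "0 < a' \<and> 0 < b'" if "0 < a" "0 < b"
      using that ab by (metis gr0I lcm_pos_nat mult_0_right less_numeral_extra(3))
  qed (use kl ab z in \<open>auto simp: prod_eq_iff\<close>)
qed

locale covariant_rep =
  fixes W :: "nat \<times> nat \<Rightarrow> 'a::cstar_algebra"
  assumes covariant: "covariant_isometric_rep UNIV_cstar W"
begin

lemma W_isometry: "x \<in> PN \<Longrightarrow> star (W x) * W x = 1"
  using covariant by (auto simp: covariant_isometric_rep_def isometric_rep_def)

lemma W_mult: "\<lbrakk>m \<noteq> 1; n \<noteq> 1; 0 < a; 0 < b\<rbrakk> \<Longrightarrow> W (m, a) * W (n, b) = W (m + a * n, a * b)"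
  using covariant unfolding covariant_isometric_rep_def isometric_rep_def
  by (metis UNIV_cstar_simps(2) in_PN pn_mult.simps)

lemma W_unit [simp]: "W (0, Suc 0) = 1"
  using covariant by (auto simp: covariant_isometric_rep_def isometric_rep_def)

text \<open>
  Since \<open>W x = (W x W x\<^sup>*) W x\<close>, the product of the two range projections can be inserted between
  \<open>W x\<^sup>*\<close> and \<open>W y\<close>, and covariance evaluates it. When \<open>pn_cup\<close> is defined, the
  result has its adjoint on the right instead of the left (\<open>star_W_mult_W_Some\<close>).
\<close>

lemma star_W_mult_W:
  assumes "x \<in> PN" "y \<in> PN"
  shows "star (W x) * W y = star (W x) * range_proj UNIV_cstar W (pn_cup x y) * W y"
proof -
  have "range_proj UNIV_cstar W (pn_cup x y) = W x * star (W x) * (W y * star (W y))"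
    using covariant assms by (auto simp: covariant_isometric_rep_def)
  then have "star (W x) * range_proj UNIV_cstar W (pn_cup x y) * W y
      = (star (W x) * W x) * (star (W x) * W y) * (star (W y) * W y)"
    by (simp add: mult.assoc)
  then show ?thesis using assms by (simp add: W_isometry)
qed

lemma star_W_mult_W_None:
  "\<lbrakk>x \<in> PN; y \<in> PN; pn_cup x y = None\<rbrakk> \<Longrightarrow> star (W x) * W y = 0"
  by (simp add: star_W_mult_W)

lemma star_W_mult_W_Some:
  assumes "0 < a" "0 < b" "0 < a'" "0 < b'" "m \<noteq> 1" "n \<noteq> 1" "k \<noteq> 1" "l \<noteq> 1"
    and cup: "pn_cup (m, a) (n, b) = Some z" "z = (m + a * k, a * a')" "z = (n + b * l, b * b')"
  shows "star (W (m, a)) * W (n, b) = W (k, a') * star (W (l, b'))"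
proof -
  have "W z = W (m, a) * W (k, a')" "W z = W (n, b) * W (l, b')"
    using assms by (metis W_mult)+
  then have "W z * star (W z) = W (m, a) * W (k, a') * (star (W (l, b')) * star (W (n, b)))"
    by (metis star_mult)
  then have "star (W (m, a)) * W (n, b) = (star (W (m, a)) * W (m, a)) * W (k, a') *
      star (W (l, b')) * (star (W (n, b)) * W (n, b))"
    using assms star_W_mult_W[of "(m, a)" "(n, b)"] by (simp add: cup(1) mult.assoc)
  then show ?thesis using assms by (simp add: W_isometry)
qed

abbreviation "s \<equiv> W (2, 1)"
abbreviation "t \<equiv> W (3, 1)"

lemma star_s_t: "star s * t = t * star s"
  using star_W_mult_W_Some[OF _ _ _ _ _ _ _ _ pn_cup_2_3, of 1 1 3 2] by simp

lemma s_s: "s * s = W (4, 1)" and t_t: "t * t = W (6, 1)" and s_s_s: "s * (s * s) = W (6, 1)"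
  using W_mult[of 2 2 1 1] W_mult[of 3 3 1 1] W_mult[of 2 4 1 1] by simp_all

lemma s_t: "s * t = t * s"
  using W_mult[of 2 3 1 1] W_mult[of 3 2 1 1] by simp

text \<open>
  The generators satisfy \<open>s\<^sup>3 = t\<^sup>2\<close>, and covariance at \<open>(2, 1), (3, 1)\<close> makes \<open>s\<^sup>*\<close> commute with \<open>t\<close>.
  So \<open>s\<^sup>2 = s\<^sup>* t\<^sup>2 = t\<^sup>2 s\<^sup>* = s\<^sup>3 s\<^sup>*\<close>, and cancelling \<open>s\<^sup>2\<close> leaves \<open>s s\<^sup>* = 1\<close>; similarly for \<open>t\<close>.
\<close>

lemma s_unitary: "star s * s = 1" "s * star s = 1"
proof -
  show iso: "star s * s = 1" by (simp add: W_isometry)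
  have "s * s = star s * (s * (s * s))" using iso by (simp add: mult.assoc[symmetric])
  also have "\<dots> = star s * t * t" by (simp add: s_s_s t_t mult.assoc del: One_nat_def)
  also have "\<dots> = t * (star s * t)" by (simp only: star_s_t mult.assoc)
  also have "\<dots> = t * t * star s" by (simp only: star_s_t mult.assoc)
  also have "\<dots> = s * s * s * star s" by (simp only: s_s_s t_t mult.assoc[of s s s])
  finally have "star s * (star s * (s * s)) = star s * (star s * (s * s * s * star s))" by simp
  moreover have c: "star s * (s * z) = z" for z using iso by (simp flip: mult.assoc)
  ultimately show "s * star s = 1"
    using iso by (simp only: mult.assoc c)
qed

lemma t_unitary: "star t * t = 1" "t * star t = 1"
proof -
  show iso: "star t * t = 1" by (simp add: W_isometry)
  have ts: "star t * s = s * star t"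
    using arg_cong[OF star_s_t, of star] by (simp only: star_mult star_star)
  have "t = star t * (t * t)" using iso by (simp add: mult.assoc[symmetric])
  also have "\<dots> = star t * (s * (s * s))" by (simp only: s_s_s t_t)
  also have "\<dots> = s * star t * s * s" by (simp only: ts flip: mult.assoc)
  also have "\<dots> = s * (s * (star t * s))" by (simp only: ts mult.assoc)
  also have "\<dots> = s * (s * s) * star t" by (simp only: ts mult.assoc)
  also have "\<dots> = t * t * star t" by (simp only: s_s_s t_t)
  finally have "star t * t = star t * (t * t * star t)" by simp
  moreover have c: "star t * (t * z) = z" for z using iso by (simp flip: mult.assoc)
  ultimately show "t * star t = 1"
    using iso by (simp only: mult.assoc c)
qed

text \<open>The unitary \<open>s\<^sup>* t\<close> translates by the missing element \<open>1\<close> of the semigroup.\<close>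

definition U :: "int \<Rightarrow> 'a" where
  "U k = signed_power (star s * t) k"

abbreviation V :: "nat \<Rightarrow> 'a" where
  "V a \<equiv> W (0, a)"

lemma u_unitary: "star (star s * t) * (star s * t) = 1" "(star s * t) * star (star s * t) = 1"
proof -
  have "star (star s * t) * (star s * t) = star t * (s * star s) * t"
    by (simp only: star_mult star_star mult.assoc)
  then show "star (star s * t) * (star s * t) = 1"
    by (simp only: s_unitary t_unitary mult_1_right)
  have "(star s * t) * star (star s * t) = star s * (t * star t) * s"
    by (simp only: star_mult star_star mult.assoc)
  then show "(star s * t) * star (star s * t) = 1"
    by (simp only: s_unitary t_unitary mult_1_right)
qed

lemma U_add: "U j * U k = U (j + k)"
  by (simp only: U_def signed_power_add[OF u_unitary])

lemma U_0 [simp]: "U 0 = 1"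
  by (simp add: U_def signed_power_def)

lemma star_U [simp]: "star (U k) = U (- k)"
  by (simp add: U_def star_signed_power)

lemma signed_power_U: "signed_power (U j) k = U (j * k)"
  by (simp only: U_def signed_power_signed_power[OF u_unitary])

lemma s_cancel: "star s * (s * z) = z" "s * (star s * z) = z"
  by (simp_all only: mult.assoc[symmetric] s_unitary mult_1_left)

lemma s_eq_U: "s = U 2" and t_eq_U: "t = U 3"
proof -
  have "U 2 = (star s * t) * (star s * t)"
    by (simp add: U_def signed_power_def power2_eq_square)
  also have "\<dots> = star s * (t * star s) * t" by (simp only: mult.assoc)
  also have "\<dots> = star s * (star s * (t * t))" by (simp only: star_s_t[symmetric] mult.assoc)
  also have "\<dots> = star s * (star s * (s * (s * s)))" by (simp only: s_s_s t_t)
  also have "\<dots> = s" by (simp only: s_cancel)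
  finally show s: "s = U 2" ..
  have "U 3 = U 2 * U 1" by (simp add: U_add)
  also have "\<dots> = s * (star s * t)" by (simp only: s[symmetric]) (simp add: U_def signed_power_def)
  also have "\<dots> = t" by (simp only: s_cancel)
  finally show "t = U 3" ..
qed

lemma W_1: "m \<noteq> 1 \<Longrightarrow> W (m, 1) = U (int m)"
proof (induction m rule: less_induct)
  case (less m)
  consider "m = 0" | "m = 3" | "m \<noteq> 3" "2 \<le> m" using less.prems by linarith
  then show ?case
  proof cases
    case 3
    then have "W (m, 1) = W (m - 2, 1) * s" 
      by (subst W_mult) (auto simp flip: add_2_eq_Suc')
    also have "\<dots> = U (int (m - 2)) * U 2" using 3 by (subst less.IH) (auto simp: s_eq_U[symmetric])
    also have "\<dots> = U (int m)" using 3 by (simp add: U_add)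
    finally show ?thesis .
  qed (use t_eq_U in auto)
qed

lemma W_eq: "\<lbrakk>m \<noteq> 1; 0 < a\<rbrakk> \<Longrightarrow> W (m, a) = U (int m) * V a"
  using W_mult[of m 0 1 a] W_1[of m] by simp

lemma V_isometry: "0 < a \<Longrightarrow> star (V a) * V a = 1"
  by (simp add: W_isometry)

lemma V_mult: "\<lbrakk>0 < a; 0 < b\<rbrakk> \<Longrightarrow> V a * V b = V (a * b)"
  using W_mult[of 0 0 a b] by simp

lemma V_U: assumes a: "0 < a" shows "V a * U k = U (int a * k) * V a"
proof -
  have pos: "V a * U (int m) = U (int a * int m) * V a" if "m \<noteq> 1" for m
  proof -
    have "V a * U (int m) = W (a * m, a)"
      using W_mult[of 0 m a 1] that a by (simp add: W_1[symmetric])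
    then show ?thesis using W_eq[of "a * m" a] that a by simp
  qed
  \<comment> \<open>an integer is a difference of two elements of the semigroup; adding \<open>2\<close> avoids the gap at \<open>1\<close>\<close>
  define n where "n = nat \<bar>k\<bar> + 2"
  define m where "m = nat (k + int n)"
  have mn: "m \<noteq> 1" "n \<noteq> 1" "k = int m + - int n" by (auto simp: m_def n_def)
  have "U (int a * k) * V a = U (int a * k) * (V a * U (int n)) * U (- int n)"
    by (simp add: mult.assoc U_add)
  also have "\<dots> = (U (int a * k) * U (int a * int n)) * V a * U (- int n)"
    by (simp only: pos[OF mn(2)] mult.assoc)
  also have "U (int a * k) * U (int a * int n) = U (int a * int m)"
    by (simp add: U_add mn(3) algebra_simps)
  also have "U (int a * int m) * V a * U (- int n) = V a * (U (int m) * U (- int n))"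
    by (simp only: pos[OF mn(1), symmetric] mult.assoc)
  also have "\<dots> = V a * U k" by (simp only: U_add mn(3))
  finally show ?thesis ..
qed

lemma U_star_V: "0 < a \<Longrightarrow> U k * star (V a) = star (V a) * U (int a * k)"
  using arg_cong[OF V_U[of a "- k"], of star] by (simp add: star_mult)

lemma star_V_mult: "\<lbrakk>0 < a; 0 < b\<rbrakk> \<Longrightarrow> star (V a) * star (V b) = star (V (b * a))"
  by (simp only: V_mult[symmetric] star_mult)

section \<open>Monomials in the translations and the multiplicative isometries\<close>

text \<open>
  Moving a large power of \<open>U\<close> through \<open>V c\<close> to the right makes the exponent on the left an element
  of the semigroup, so that covariance applies to products containing \<open>U n * V c\<close>.
\<close>

lemma U_V_eq_W:
  assumes "0 < c"
  obtains m N where "m \<noteq> 1" "U n * V c = W (m, c) * U (- int N)" "int m = n + int c * int N"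
proof -
  define N where "N = nat \<bar>n\<bar> + 2"
  define m where "m = nat (n + int c * int N)"
  have "int N \<le> int c * int N" using assms mult_right_mono[of 1 "int c" "int N"] by simp
  then have m: "int m = n + int c * int N" "m \<noteq> 1" by (auto simp: m_def N_def)
  have "W (m, c) * U (- int N) = U (int m) * (U (int c * - int N) * V c)"
    by (simp only: W_eq[OF m(2) assms] mult.assoc V_U[OF assms])
  also have "\<dots> = U n * V c" by (simp only: mult.assoc[symmetric] U_add) (simp add: m(1))
  finally show ?thesis using that m by metis
qed

lemma star_V_U_V_dvd: "0 < c \<Longrightarrow> star (V c) * U (int c * k) * V c = U k"
  by (simp only: mult.assoc V_U[symmetric]) (simp add: V_isometry flip: mult.assoc)

text \<open>
  The ranges of \<open>V c\<close> and \<open>U n * V c\<close> are orthogonal because \<open>0\<close> and \<open>n\<close> lie in different residue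
  classes modulo \<open>c\<close>.
\<close>

lemma star_V_U_V_not_dvd:
  assumes "0 < c" "\<not> int c dvd n"
  shows "star (V c) * U n * V c = 0"
proof -
  obtain m N where m: "m \<noteq> 1" "U n * V c = W (m, c) * U (- int N)" "int m = n + int c * int N"
    using U_V_eq_W[OF assms(1)] .
  have "P_coset 0 c \<inter> P_coset m c = {}"
  proof (rule ccontr)
    assume "P_coset 0 c \<inter> P_coset m c \<noteq> {}"
    then obtain k l where "c * k = m + c * l" by (auto simp: in_P_coset)
    then have "int c * int k = int m + int c * int l" by (metis of_nat_add of_nat_mult)
    then have "n = int c * (int k - int l - int N)" by (simp add: m(3) algebra_simps)
    then show False using assms(2) by simp
  qed
  then have "star (V c) * W (m, c) = 0"
    using assms m by (intro star_W_mult_W_None) auto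
  then show ?thesis by (simp add: mult.assoc m(2) flip: mult.assoc[of _ "W (m, c)"])
qed

text \<open>
  The equation \<open>b * b' = c * c'\<close> (both sides are the least common multiple) records that the
  quotient \<open>c / b\<close> of the multiplicative parts is preserved. This is what decides later whether
  the state vanishes.
\<close>

lemma star_V_U_V:
  assumes "0 < b" "0 < c"
  obtains "star (V b) * U n * V c = 0"
  | p b' c' q where "0 < b'" "0 < c'" "b * b' = c * c'"
      "star (V b) * U n * V c = U p * V b' * star (V c') * U q"
proof -
  obtain m N where m: "m \<noteq> 1" "U n * V c = W (m, c) * U (- int N)" "int m = n + int c * int N"
    using U_V_eq_W[OF assms(2)] .
  have *: "star (V b) * U n * V c = star (V b) * W (m, c) * U (- int N)"
    by (simp add: mult.assoc m(2))
  show ?thesis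
  proof (cases "pn_cup (0, b) (m, c)")
    case None
    then have "star (V b) * W (m, c) = 0"
      using assms m by (intro star_W_mult_W_None) auto
    then show ?thesis using that(1) * by simp
  next
    case (Some z)
    obtain k l b' c' where k: "k \<noteq> 1" "l \<noteq> 1" "0 < b \<Longrightarrow> 0 < c \<Longrightarrow> 0 < b' \<and> 0 < c'"
      "z = (0 + b * k, b * b')" "z = (m + c * l, c * c')"
      using pn_cup_SomeD[OF Some] by metis
    have pos: "0 < b'" "0 < c'" using k(3) assms by auto
    have "star (V b) * W (m, c) = W (k, b') * star (W (l, c'))"
      using star_W_mult_W_Some[OF assms pos _ m(1) k(1,2) Some k(4,5)] by simp
    also have "\<dots> = U (int k) * V b' * star (V c') * U (- int l)"
      by (simp only: W_eq[OF k(1) pos(1)] W_eq[OF k(2) pos(2)] star_mult star_U mult.assoc)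
    finally have "star (V b) * U n * V c
        = U (int k) * V b' * star (V c') * U (- int l + - int N)"
      unfolding * by (simp only: mult.assoc U_add)
    then show ?thesis using that(2) pos k(4,5) by blast
  qed
qed

text \<open>
  All integers are allowed as exponents, and the right factor \<open>U k\<close> is not an adjoint. So the
  translations act by \<open>j + n\<close> and \<open>k + n\<close>, and cyclically moving a power of \<open>U\<close> preserves \<open>j + k\<close>.
\<close>

definition monomial :: "int \<Rightarrow> nat \<Rightarrow> nat \<Rightarrow> int \<Rightarrow> 'a" where
  "monomial j a b k = U j * V a * star (V b) * U k"

lemma U_mult_monomial: "U n * monomial j a b k = monomial (n + j) a b k"
  by (simp add: monomial_def U_add flip: mult.assoc)

lemma monomial_mult_U: "monomial j a b k * U n = monomial j a b (k + n)"
  by (simp add: monomial_def U_add mult.assoc)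

lemma V_mult_monomial:
  assumes "0 < a" "0 < c" shows "V c * monomial j a b k = monomial (int c * j) (c * a) b k"
proof -
  have "V c * monomial j a b k = (V c * U j) * V a * star (V b) * U k"
    by (simp only: monomial_def mult.assoc)
  also have "\<dots> = U (int c * j) * (V c * V a) * star (V b) * U k"
    using assms by (simp only: V_U mult.assoc)
  finally show ?thesis using assms by (simp only: V_mult monomial_def)
qed

lemma monomial_mult_star_V:
  assumes "0 < b" "0 < c"
  shows "monomial j a b k * star (V c) = monomial j a (c * b) (int c * k)"
proof -
  have "monomial j a b k * star (V c) = U j * V a * (star (V b) * star (V c)) * U (int c * k)"
    using assms by (simp only: monomial_def mult.assoc U_star_V)
  then show ?thesis using assms by (simp only: star_V_mult monomial_def)
qed

lemma star_monomial: "star (monomial j a b k) = monomial (- k) b a (- j)"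
  by (simp add: monomial_def star_mult star_star mult.assoc)

lemma monomial_mult_V:
  assumes "0 < a" "0 < b" "0 < c"
  obtains "monomial j a b k * V c = 0"
  | p b' c' q where "0 < b'" "0 < c'" "b * b' = c * c'"
      "monomial j a b k * V c = monomial p (a * b') c' q"
proof -
  have *: "monomial j a b k * V c = U j * V a * (star (V b) * U k * V c)"
    by (simp only: monomial_def mult.assoc)
  show ?thesis
  proof (cases rule: star_V_U_V[OF assms(2,3), of k])
    case 1
    then show ?thesis using that(1) * by simp
  next
    case (2 p b' c' q)
    have "monomial j a b k * V c = U j * (V a * monomial p b' c' q)"
      unfolding * 2(4) by (simp only: monomial_def mult.assoc)
    then show ?thesis
      using that(2) 2 assms by (simp add: V_mult_monomial U_mult_monomial)
  qed
qed

lemma monomial_mult: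
  assumes "0 < a" "0 < b" "0 < c" "0 < d"
  obtains "monomial j a b k * monomial i c d l = 0"
  | p a' b' q where "0 < a'" "0 < b'" "monomial j a b k * monomial i c d l = monomial p a' b' q"
proof -
  have *: "monomial j a b k * monomial i c d l
      = monomial j a b (k + i) * V c * star (V d) * U l"
    by (simp only: monomial_mult_U[symmetric]) (simp only: monomial_def mult.assoc)
  show ?thesis
  proof (cases rule: monomial_mult_V[OF assms(1-3), of j "k + i"])
    case 1
    then show ?thesis using that(1) * by simp
  next
    case (2 p b' c' q)
    then show ?thesis
      using that(2)[of "a * b'" "d * c'"] assms by (simp add: * monomial_mult_star_V monomial_mult_U)
  qed
qed

lemma word_eq_monomial:
  assumes "0 < a" "0 < b"
  shows "s ^ x1 * t ^ y1 * V a * star (V b) * star t ^ y2 * star s ^ x2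
    = monomial (int (2 * x1 + 3 * y1)) a b (- int (2 * x2 + 3 * y2))"
proof -
  have pow: "U j ^ n = U (j * int n)" for j n
    using signed_power_U[of j "int n"] by simp
  have "s ^ x1 * t ^ y1 * V a * star (V b) * star t ^ y2 * star s ^ x2
      = (U (2 * int x1) * U (3 * int y1)) * V a * star (V b) * (U (- 3 * int y2) * U (- 2 * int x2))"
    by (simp only: s_eq_U t_eq_U star_U pow mult.assoc)
  then show ?thesis by (simp only: U_add monomial_def) (simp add: algebra_simps)
qed

lemma signed_word_eq_U: "signed_power t i * signed_power s j = U (3 * i + 2 * j)"
  by (simp only: s_eq_U t_eq_U signed_power_U U_add)

text \<open>
  The exponents of a monomial are not unique: \<open>U n * U (- n)\<close> can be inserted between \<open>V a\<close> and
  \<open>star (V b)\<close> and moved outwards.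
\<close>

lemma monomial_shift:
  assumes "0 < a" "0 < b"
  shows "monomial (j + int a * n) a b (k - int b * n) = monomial j a b k"
proof -
  have "monomial (j + int a * n) a b (k - int b * n)
      = U j * (U (int a * n) * V a) * (star (V b) * U (int b * - n)) * U k"
    by (simp only: mult.assoc U_add monomial_def) (simp add: U_add algebra_simps flip: mult.assoc)
  also have "\<dots> = U j * V a * (U n * U (- n)) * star (V b) * U k"
    using assms by (simp only: V_U[symmetric] U_star_V[symmetric] mult.assoc)
  finally show ?thesis by (simp add: U_add monomial_def)
qed

text \<open>
  A shift makes the left exponent at least \<open>2\<close> and the right one at most \<open>-2\<close>, which puts both into
  the range of the words in \<open>s\<close> and \<open>t\<close>.
\<close>

lemma monomial_eq_word:
  assumes "0 < a" "0 < b"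
  obtains x1 y1 x2 y2 :: nat where
    "2 * x1 + 3 * y1 \<noteq> 1" "2 * x2 + 3 * y2 \<noteq> 1"
    "monomial j a b k = s ^ x1 * t ^ y1 * V a * star (V b) * star t ^ y2 * star s ^ x2"
    "a = b \<Longrightarrow> int (2 * x1 + 3 * y1) - int (2 * x2 + 3 * y2) = j + k"
proof -
  have decomp: "\<exists>x y. m = 2 * x + 3 * y" if "m \<noteq> 1" for m :: nat
    using that by presburger
  define N where "N = \<bar>j\<bar> + \<bar>k\<bar> + 2"
  have "1 * N \<le> int a * N" "1 * N \<le> int b * N"
    by (rule mult_right_mono; use assms in \<open>simp add: N_def\<close>)+
  moreover have "2 - j \<le> N" "2 + k \<le> N" by (simp_all add: N_def)
  ultimately have N: "2 \<le> j + int a * N" "2 \<le> int b * N - k" by linarith+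
  define m n where "m = nat (j + int a * N)" and "n = nat (int b * N - k)"
  have mn: "int m = j + int a * N" "int n = int b * N - k" "m \<noteq> 1" "n \<noteq> 1"
    using N by (auto simp: m_def n_def)
  obtain x1 y1 x2 y2 where x: "m = 2 * x1 + 3 * y1" "n = 2 * x2 + 3 * y2"
    using decomp mn by metis
  have "monomial j a b k = monomial (int m) a b (- int n)"
    using monomial_shift[OF assms, of j N k] by (simp add: mn)
  then show ?thesis
    using that[of x1 y1 x2 y2] word_eq_monomial[OF assms, of x1 y1 y2 x2] mn unfolding x by simp
qed

lemma W_eq_monomial: "\<lbrakk>m \<noteq> 1; 0 < a\<rbrakk> \<Longrightarrow> W (m, a) = monomial (int m) a 1 0"
  using W_eq[of m a] by (simp add: monomial_def)

end

section \<open>Density of the monomials\<close>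

lemma subspace_closure:
  fixes S :: "'a::real_normed_vector set"
  assumes "subspace S"
  shows "subspace (closure S)"
proof (rule subspaceI)
  show "0 \<in> closure S" by (rule subsetD[OF closure_subset subspace_0[OF assms]])
next
  fix x y assume x: "x \<in> closure S" and y: "y \<in> closure S"
  obtain f where f: "\<forall>n. f n \<in> S" "f \<longlonglongrightarrow> x" using x by (auto simp: closure_sequential)
  obtain g where g: "\<forall>n. g n \<in> S" "g \<longlonglongrightarrow> y" using y by (auto simp: closure_sequential)
  have "\<forall>n. f n + g n \<in> S" using f g subspace_add[OF assms] by simp
  moreover have "(\<lambda>n. f n + g n) \<longlonglongrightarrow> x + y" using f g by (intro tendsto_add)
  ultimately show "x + y \<in> closure S"
    unfolding closure_sequential by (intro exI[of _ "\<lambda>n. f n + g n"] conjI)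
next
  fix c x assume x: "x \<in> closure S"
  obtain f where f: "\<forall>n. f n \<in> S" "f \<longlonglongrightarrow> x" using x by (auto simp: closure_sequential)
  have "\<forall>n. c *\<^sub>R f n \<in> S" using f subspace_scale[OF assms] by simp
  moreover have "(\<lambda>n. c *\<^sub>R f n) \<longlonglongrightarrow> c *\<^sub>R x" using f by (intro tendsto_scaleR tendsto_const)
  ultimately show "c *\<^sub>R x \<in> closure S"
    unfolding closure_sequential by (intro exI[of _ "\<lambda>n. c *\<^sub>R f n"] conjI)
qed

text \<open>
  For the closed span to be invariant under \<open>f\<close> it suffices to know \<open>f\<close> on the spanning set. This is
  applied first to right multiplication by spanning elements and then to left multiplication by
  arbitrary elements of the closed span.
\<close>

lemma bounded_linear_closure_span:
  fixes f :: "'a::real_normed_vector \<Rightarrow> 'a"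
  assumes f: "bounded_linear f" and M: "\<And>x. x \<in> M \<Longrightarrow> f x \<in> closure (span M)"
    and x: "x \<in> closure (span M)"
  shows "f x \<in> closure (span M)"
proof -
  have "f ` span M = span (f ` M)"
    using linear_span_image[OF bounded_linear.linear[OF f]] by simp
  also have "\<dots> \<subseteq> closure (span M)"
    using M by (intro span_minimal subspace_closure subspace_span) auto
  finally have "closure (f ` span M) \<subseteq> closure (span M)" by (simp add: closure_minimal)
  then show ?thesis
    using closure_bounded_linear_image_subset[OF f, of "span M"] x by blast
qed

lemma sub_cstar_closure_span:
  fixes M :: "'a::cstar_algebra set"
  assumes mult: "\<And>x y. \<lbrakk>x \<in> M; y \<in> M\<rbrakk> \<Longrightarrow> x * y \<in> M"
    and scale: "\<And>c x. x \<in> M \<Longrightarrow> c *\<^sub>C x \<in> M"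
    and star: "\<And>x. x \<in> M \<Longrightarrow> star x \<in> M"
  shows "sub_cstar UNIV_cstar (closure (span M))" (is "sub_cstar _ ?C")
proof -
  have sub: "subspace ?C" by (intro subspace_closure subspace_span)
  have MC: "x \<in> ?C" if "x \<in> M" for x
    using that span_base closure_subset by blast
  have "x * y \<in> ?C" if "x \<in> ?C" "y \<in> M" for x y
    by (rule bounded_linear_closure_span[OF bounded_linear_mult_left _ that(1)])
      (use mult that MC in auto)
  then have "x * y \<in> ?C" if "x \<in> ?C" "y \<in> ?C" for x y
    using that(1) by (intro bounded_linear_closure_span[OF bounded_linear_mult_right _ that(2)])
  moreover have "c *\<^sub>C x \<in> ?C" if "x \<in> ?C" for c x
    by (rule bounded_linear_closure_span[OF bounded_linear_scaleC _ that]) (use scale MC in auto)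
  moreover have "star x \<in> ?C" if "x \<in> ?C" for x
    by (rule bounded_linear_closure_span[OF bounded_linear_star _ that]) (use star MC in auto)
  moreover have "x \<in> ?C" if "\<forall>e>0. \<exists>y\<in>?C. norm (x - y) < e" for x
  proof -
    have "x \<in> closure ?C"
      unfolding closure_approachable[of x ?C] using that by (simp add: dist_norm norm_minus_commute)
    then show ?thesis by simp
  qed
  ultimately show ?thesis
    using subspace_0[OF sub] subspace_add[OF sub] by (simp add: sub_cstar_def)
qed

locale generating_rep = covariant_rep +
  assumes generates: "cstar_generated UNIV_cstar (W ` PN) = UNIV"
begin

text \<open>
  Complex multiples of monomials are closed under multiplication and adjoints, so their closed real
  span is a \<open>C\<^sup>*\<close>-subalgebra; it contains the generators and is therefore everything.
\<close>

lemma eq_if_eq_on_monomials: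
  fixes f g :: "'a \<Rightarrow> complex"
  assumes f: "bounded_linear f" "\<And>c x. f (c *\<^sub>C x) = c * f x"
    and g: "bounded_linear g" "\<And>c x. g (c *\<^sub>C x) = c * g x"
    and eq: "\<And>j a b k. \<lbrakk>0 < a; 0 < b\<rbrakk> \<Longrightarrow> f (monomial j a b k) = g (monomial j a b k)"
  shows "f x = g x"
proof -
  define M where "M = {c *\<^sub>C monomial j a b k | c j a b k. 0 < a \<and> 0 < b}"
  have zero: "0 \<in> M"
    unfolding M_def by (intro CollectI exI[of _ 0] exI[of _ "1::nat"]) simp
  have "sub_cstar UNIV_cstar (closure (span M))"
  proof (rule sub_cstar_closure_span)
    fix x y assume "x \<in> M" "y \<in> M"
    then obtain c j a b k c' j' a' b' k' where
      *: "0 < a" "0 < b" "0 < a'" "0 < b'" "x = c *\<^sub>C monomial j a b k" "y = c' *\<^sub>C monomial j' a' b' k'"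
      unfolding M_def by blast
    have xy: "x * y = (c' * c) *\<^sub>C (monomial j a b k * monomial j' a' b' k')"
      by (simp add: * mult_scaleC_left mult_scaleC_right scaleC_scaleC)
    show "x * y \<in> M"
    proof (cases rule: monomial_mult[OF *(1-4), of j k j' k'])
      case 1
      then have "x * y = 0"
        using linear_0[OF bounded_linear.linear[OF bounded_linear_scaleC]] by (simp add: xy)
      then show ?thesis using zero by (simp only:)
    next
      case (2 p a' b' q)
      then have "x * y = (c' * c) *\<^sub>C monomial p a' b' q" by (simp only: xy)
      then show ?thesis unfolding M_def using 2(1,2) by blast
    qed
  next
    fix c x assume "x \<in> M"
    then show "c *\<^sub>C x \<in> M" unfolding M_def by (force simp: scaleC_scaleC)
  next
    fix x assume "x \<in> M"
    then show "star x \<in> M" unfolding M_def by (force simp: star_scaleC star_monomial)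
  qed
  moreover have "W x \<in> M" if x_PN: "x \<in> PN" for x
  proof -
    obtain m a where x: "x = (m, a)" "m \<noteq> 1" "0 < a" using x_PN by (metis in_PN surj_pair)
    then have "W x = 1 *\<^sub>C monomial (int m) a 1 0"
      using W_eq_monomial[OF x(2,3)] by (simp only: scaleC_1)
    then show ?thesis unfolding M_def using x(3) by blast
  qed
  then have "W ` PN \<subseteq> closure (span M)" using span_base closure_subset by blast
  ultimately have "closure (span M) = UNIV"
    using generates unfolding cstar_generated_def by blast
  moreover have "closure (span M) \<subseteq> {x. f x = g x}"
  proof (rule closure_minimal)
    show "closed {x. f x = g x}"
      by (intro closed_Collect_eq linear_continuous_on f g)
    have "subspace {x. f x = g x}"
      using linear_subspace_kernel[OF bounded_linear.linear[OF bounded_linear_sub[OF f(1) g(1)]]]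
      by simp
    moreover have "M \<subseteq> {x. f x = g x}" by (auto simp: M_def f g eq)
    ultimately show "span M \<subseteq> {x. f x = g x}" by (rule span_minimal[rotated])
  qed
  ultimately show ?thesis by auto
qed

end

section \<open>The KMS relation on monomials\<close>

text \<open>
  The formula for the state combines the two conditions on words in the generators into one
  statement about monomials. It depends on \<open>j\<close> and \<open>k\<close> only through \<open>j + k\<close>.
\<close>

locale kms_formula = generating_rep W
  for W :: "nat \<times> nat \<Rightarrow> 'a::cstar_algebra" +
  fixes \<phi> :: "'a \<Rightarrow> complex" and \<beta> :: real
  assumes state: "state \<phi>"
    and formula: "\<And>j a b k. \<lbrakk>0 < a; 0 < b\<rbrakk> \<Longrightarrow> \<phi> (monomial j a b k) =
      (if a = b \<and> int a dvd j + k
       then complex_of_real (real a powr (- \<beta>)) * \<phi> (U ((j + k) div int a)) else 0)"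
begin

lemma \<phi>_linear: "bounded_linear \<phi>" and \<phi>_scaleC: "\<phi> (c *\<^sub>C x) = c * \<phi> x"
  and \<phi>_pos: "\<phi> (star x * x) \<in> \<real>\<^sub>\<ge>\<^sub>0"
  using state by (auto simp: state_def)

lemmas \<phi>_add = bounded_linear.linear[OF \<phi>_linear, THEN linear_add]
lemmas \<phi>_diff = bounded_linear.linear[OF \<phi>_linear, THEN linear_diff]
lemmas \<phi>_zero [simp] = bounded_linear.linear[OF \<phi>_linear, THEN linear_0]

lemma \<phi>_star: "\<phi> (star x) = cnj (\<phi> x)"
  by (rule positive_functional_star[OF \<phi>_add \<phi>_scaleC \<phi>_pos])

lemma bounded_linear_\<phi>_mult: "bounded_linear (\<lambda>x. \<phi> (x * d))" "bounded_linear (\<lambda>x. \<phi> (d * x))"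
  by (rule bounded_linear_compose[OF \<phi>_linear], rule bounded_linear_mult_left bounded_linear_mult_right)+

text \<open>
  The KMS relation with \<open>d\<close> on the right, for an eigenvector \<open>d\<close> of the dynamics with
  \<open>\<sigma>\<^sub>r(d) = exp (\<i> r l) d\<close>. The weight \<open>l\<close> is additive in \<open>d\<close>, being the logarithm of the factor
  \<open>a / b\<close> of a monomial.
\<close>

definition twisted :: "'a \<Rightarrow> real \<Rightarrow> bool" where
  "twisted d l \<longleftrightarrow> (\<forall>x. \<phi> (x * d) = of_real (exp (\<beta> * l)) * \<phi> (d * x))"

lemma twistedI:
  assumes "\<And>j a b k. \<lbrakk>0 < a; 0 < b\<rbrakk> \<Longrightarrow>
    \<phi> (monomial j a b k * d) = of_real (exp (\<beta> * l)) * \<phi> (d * monomial j a b k)"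
  shows "twisted d l"
  unfolding twisted_def
proof
  fix x
  show "\<phi> (x * d) = of_real (exp (\<beta> * l)) * \<phi> (d * x)"
  proof (rule eq_if_eq_on_monomials[where f = "\<lambda>x. \<phi> (x * d)"])
    show "bounded_linear (\<lambda>x. of_real (exp (\<beta> * l)) * \<phi> (d * x))"
      by (rule bounded_linear_compose[OF bounded_linear_mult_right bounded_linear_\<phi>_mult(2)])
  qed (use assms in \<open>auto simp: bounded_linear_\<phi>_mult mult_scaleC_left mult_scaleC_right \<phi>_scaleC\<close>)
qed

lemma twisted_mult:
  assumes "twisted d l" "twisted e m" shows "twisted (d * e) (l + m)"
  unfolding twisted_def
proof
  fix x
  have "\<phi> (x * (d * e)) = \<phi> ((x * d) * e)" by (simp only: mult.assoc)
  also have "\<dots> = of_real (exp (\<beta> * m)) * \<phi> (e * (x * d))"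
    using assms(2) by (simp add: twisted_def)
  also have "of_real (exp (\<beta> * m)) * \<phi> (e * (x * d))
      = of_real (exp (\<beta> * m)) * (of_real (exp (\<beta> * l)) * \<phi> (d * e * x))"
    using assms(1)[unfolded twisted_def, rule_format, of "e * x"] by (simp add: mult.assoc)
  also have "\<dots> = of_real (exp (\<beta> * (l + m))) * \<phi> (d * e * x)"
    by (simp only: distrib_left exp_add of_real_mult mult_ac)
  finally show "\<phi> (x * (d * e)) = of_real (exp (\<beta> * (l + m))) * \<phi> (d * e * x)" .
qed

text \<open>Since the state is hermitian, conjugating the relation for \<open>star x\<close> exchanges the two sides.\<close>

lemma twisted_star:
  assumes "twisted d l" shows "twisted (star d) (- l)"
  unfolding twisted_def
proof
  fix x
  have "\<phi> (star x * d) = of_real (exp (\<beta> * l)) * \<phi> (d * star x)"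
    using assms by (simp add: twisted_def)
  then have "\<phi> (star (star x * d)) = of_real (exp (\<beta> * l)) * \<phi> (star (d * star x))"
    by (simp only: \<phi>_star complex_cnj_mult complex_cnj_complex_of_real)
  then have "\<phi> (star d * x) = of_real (exp (\<beta> * l)) * \<phi> (x * star d)"
    by (simp only: star_mult star_star)
  then show "\<phi> (x * star d) = of_real (exp (\<beta> * - l)) * \<phi> (star d * x)"
    by (simp add: exp_minus)
qed

lemma twisted_U: "twisted (U n) 0"
  by (rule twistedI) (auto simp: U_mult_monomial monomial_mult_U formula add_ac)

text \<open>
  Multiplying \<open>monomial j a b k\<close> by \<open>V c\<close> on either side leads to weight \<open>c a / b\<close>, so both values
  vanish unless \<open>b = c a\<close>. In that case \<open>star (V b)\<close> contains \<open>star (V c)\<close>, which meets \<open>V c\<close> across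
  \<open>U k\<close>: if \<open>k = c i\<close>, the two monomials have multiplicative parts \<open>a\<close> and \<open>c a\<close> and total exponents
  \<open>j + i\<close> and \<open>c (j + i)\<close>, so the state sees the same power of \<open>u\<close> with coefficients differing by
  the factor \<open>c\<close> to the power \<open>\<beta>\<close>. Otherwise both values are \<open>0\<close>.
\<close>

lemma twisted_V:
  assumes c: "0 < c" shows "twisted (V c) (ln c)"
proof (rule twistedI)
  fix j k a b assume ab: "0 < (a::nat)" "0 < (b::nat)"
  have V_mult: "\<phi> (V c * monomial j a b k) = (if c * a = b \<and> int b dvd int c * j + k
       then complex_of_real (real b powr (- \<beta>)) * \<phi> (U ((int c * j + k) div int b)) else 0)"
    using formula[of "c * a" b "int c * j" k] ab c
    by (auto simp: V_mult_monomial simp del: of_nat_mult)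
  show "\<phi> (monomial j a b k * V c) = of_real (exp (\<beta> * ln c)) * \<phi> (V c * monomial j a b k)"
  proof (cases "c * a = b")
    case False
    have "\<phi> (monomial j a b k * V c) = 0"
    proof (cases rule: monomial_mult_V[OF ab c, of j k])
      case (2 p b' c' q)
      have "a * b' \<noteq> c'"
      proof
        assume "a * b' = c'"
        with 2(3) have "b * b' = (c * a) * b'" by (simp add: mult.assoc)
        with 2(1) False show False by simp
      qed
      then show ?thesis using 2 ab by (simp add: formula)
    qed simp
    then show ?thesis using False by (simp add: V_mult)
  next
    case True
    have *: "monomial j a b k * V c = U j * V a * star (V a) * (star (V c) * U k * V c)"
      using ab c by (simp only: monomial_def True[symmetric] star_V_mult[symmetric] mult.assoc)
    show ?thesis
    proof (cases "int c dvd k")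
      case False
      then have "\<not> int b dvd int c * j + k"
        unfolding True[symmetric] by (metis dvd_add_right_iff dvd_mult_left dvd_triv_left of_nat_mult)
      then show ?thesis using False c by (simp add: V_mult * star_V_U_V_not_dvd)
    next
      case True2: True
      then obtain i where k: "k = int c * i" by blast
      have "monomial j a b k * V c = monomial j a a i"
        using * by (simp only: k star_V_U_V_dvd[OF c] monomial_def)
      moreover have "int c * j + k = int c * (j + i)" "int b = int c * int a"
        by (simp_all add: k True[symmetric] distrib_left)
      moreover have exp_powr: "exp (\<beta> * ln c) * real b powr - \<beta> = real a powr - \<beta>"
        using ab c by (simp add: powr_def True[symmetric] ln_mult exp_add[symmetric] algebra_simps)
      have "complex_of_real (exp (\<beta> * ln c)) * complex_of_real (real b powr - \<beta>)
          = complex_of_real (real a powr - \<beta>)"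
        by (simp only: exp_powr[symmetric] of_real_mult)
      ultimately show ?thesis using ab c True by (simp add: V_mult formula)
    qed
  qed
qed

lemma twisted_monomial:
  assumes "0 < a" "0 < b" shows "twisted (monomial j a b k) (ln a - ln b)"
  using twisted_mult[OF twisted_mult[OF twisted_mult[OF twisted_U[of j] twisted_V[OF assms(1)]]
        twisted_star[OF twisted_V[OF assms(2)]]] twisted_U[of k]]
  by (simp add: monomial_def)

end

section \<open>The dynamics and the KMS condition\<close>

locale kms_dynamics = kms_formula W \<phi> \<beta>
  for W :: "nat \<times> nat \<Rightarrow> 'a::cstar_algebra" and \<phi> \<beta> +
  fixes \<sigma> :: "real \<Rightarrow> 'a \<Rightarrow> 'a"
  assumes dynamics: "dynamics W \<sigma>"
begin

lemma
  shows \<sigma>_add: "\<sigma> r (x + y) = \<sigma> r x + \<sigma> r y"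
    and \<sigma>_mult: "\<sigma> r (x * y) = \<sigma> r x * \<sigma> r y"
    and \<sigma>_scaleC: "\<sigma> r (c *\<^sub>C x) = c *\<^sub>C \<sigma> r x"
    and \<sigma>_star: "\<sigma> r (star x) = star (\<sigma> r x)"
    and \<sigma>_surj: "\<exists>x. \<sigma> r x = y"
    and \<sigma>_s: "\<sigma> r s = s" and \<sigma>_t: "\<sigma> r t = t"
    and \<sigma>_V_prime: "prime p \<Longrightarrow> \<sigma> r (V p) = (of_nat p powr (\<i> * of_real r)) *\<^sub>C V p"
proof -
  have hom: "star_hom UNIV_cstar UNIV_cstar (\<sigma> r)" and bij: "bij (\<sigma> r)"
    using dynamics by (auto simp: dynamics_def strongly_continuous_action_def)
  show "\<sigma> r (x + y) = \<sigma> r x + \<sigma> r y" "\<sigma> r (x * y) = \<sigma> r x * \<sigma> r y"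
    "\<sigma> r (c *\<^sub>C x) = c *\<^sub>C \<sigma> r x" "\<sigma> r (star x) = star (\<sigma> r x)"
    using hom by (simp_all add: star_hom_def)
  show "\<exists>x. \<sigma> r x = y" using bij by (metis bij_pointE)
qed (use dynamics in \<open>simp_all add: dynamics_def\<close>)

text \<open>A surjective homomorphism maps the unit to a unit of the whole algebra.\<close>

lemma \<sigma>_one: "\<sigma> r 1 = 1"
proof -
  obtain y where "\<sigma> r y = 1" using \<sigma>_surj by blast
  then show ?thesis using \<sigma>_mult[of r 1 y] by simp
qed

lemma \<sigma>_U: "\<sigma> r (U n) = U n"
proof -
  have pow: "\<sigma> r (x ^ m) = \<sigma> r x ^ m" for x m
    by (induction m) (auto simp: \<sigma>_one \<sigma>_mult)
  show ?thesis
    by (simp only: U_def signed_power_def if_distrib[of "\<sigma> r"] pow \<sigma>_star \<sigma>_mult \<sigma>_s \<sigma>_t)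
qed

lemma \<sigma>_V: "0 < a \<Longrightarrow> \<sigma> r (V a) = exp (\<i> * of_real (r * ln a)) *\<^sub>C V a"
proof (induction a rule: less_induct)
  case (less a)
  show ?case
  proof (cases "a = 1")
    case True
    then show ?thesis by (simp add: \<sigma>_one)
  next
    case False
    then obtain p b where p: "prime p" "a = p * b" by (metis prime_factor_nat dvdE)
    have pos: "0 < p" "0 < b" "b < a" using p less.prems prime_gt_1_nat[OF p(1)] by auto
    have "\<sigma> r (V a) = \<sigma> r (V p) * \<sigma> r (V b)"
      using pos by (simp add: p(2) V_mult[symmetric] \<sigma>_mult)
    also have "\<dots> = (of_nat p powr (\<i> * of_real r) * exp (\<i> * of_real (r * ln b))) *\<^sub>C (V p * V b)"
      using pos by (simp add: \<sigma>_V_prime[OF p(1)] less.IH mult_scaleC_left mult_scaleC_right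
          scaleC_scaleC mult.commute)
    also have "of_nat p powr (\<i> * of_real r) = exp (\<i> * of_real (r * ln p))"
      using pos by (simp add: powr_def algebra_simps)
    finally show ?thesis
      using pos by (simp add: p(2) V_mult scaleC_scaleC ln_mult exp_add[symmetric] algebra_simps)
  qed
qed

lemma \<sigma>_monomial:
  assumes "0 < a" "0 < b"
  shows "\<sigma> r (monomial j a b k) = exp (\<i> * of_real (r * (ln a - ln b))) *\<^sub>C monomial j a b k"
proof -
  have *: "exp (\<i> * of_real (r * (ln a - ln b)))
      = cnj (exp (\<i> * of_real (r * ln b))) * exp (\<i> * of_real (r * ln a))"
    by (simp add: exp_cnj right_diff_distrib flip: exp_add)
  show ?thesis
    using assms by (simp only: monomial_def \<sigma>_mult \<sigma>_U \<sigma>_star \<sigma>_V star_scaleC mult_scaleC_left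
        mult_scaleC_right scaleC_scaleC *)
qed

text \<open>
  A monomial with \<open>a = b\<close> is fixed by \<open>\<sigma> r\<close>, and \<open>\<phi>\<close> vanishes on the others. Boundedness of the
  composition comes from its positivity.
\<close>

lemma \<phi>_\<sigma>: "\<phi> (\<sigma> r x) = \<phi> x"
proof (rule eq_if_eq_on_monomials[where f = "\<lambda>x. \<phi> (\<sigma> r x)"])
  show "bounded_linear (\<lambda>x. \<phi> (\<sigma> r x))"
    by (rule positive_functional_bounded) (simp_all add: \<sigma>_add \<phi>_add \<sigma>_scaleC \<phi>_scaleC \<sigma>_mult \<sigma>_star \<phi>_pos)
next
  fix j k a b assume "0 < (a::nat)" "0 < (b::nat)"
  then show "\<phi> (\<sigma> r (monomial j a b k)) = \<phi> (monomial j a b k)"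
    by (cases "a = b") (simp_all add: \<sigma>_monomial \<phi>_scaleC formula)
qed (simp_all add: \<sigma>_scaleC \<phi>_scaleC \<phi>_linear)

text \<open>
  For real \<open>r\<close>, invariance gives \<open>\<phi> (c d) = \<phi> (\<sigma>\<^sub>r(c) \<sigma>\<^sub>r(d)) = exp (\<i> r l) \<phi> (\<sigma>\<^sub>r(c) d)\<close>, and the relation
  for \<open>d\<close> moves \<open>d\<close> to the left at the cost of the factor \<open>exp (\<beta> l)\<close>. The resulting identity between
  entire functions of \<open>r\<close> persists at \<open>\<i> \<beta>\<close>, where the two exponentials cancel.
\<close>

lemma KMS_monomial:
  assumes F: "analytic_extension \<sigma> c F" and ab: "0 < a" "0 < b" and d: "d = monomial j a b k"
  shows "\<phi> (c * d) = \<phi> (d * F (\<i> * of_real \<beta>))"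
proof -
  define l where "l = ln (real a) - ln (real b)"
  define G where "G = (\<lambda>z. exp (\<i> * z * of_real l) * of_real (exp (\<beta> * l)) * \<phi> (d * F z) - \<phi> (c * d))"
  have "\<exists>D. ((\<lambda>z. \<phi> (d * F z)) has_field_derivative D) (at z)" for z
  proof -
    obtain D where "((\<lambda>h. inverse h *\<^sub>C (F (z + h) - F z)) \<longlongrightarrow> D) (at 0)"
      using F by (auto simp: analytic_extension_def entire_def)
    then have "((\<lambda>h. \<phi> (d * (inverse h *\<^sub>C (F (z + h) - F z)))) \<longlongrightarrow> \<phi> (d * D)) (at 0)"
      by (rule bounded_linear.tendsto[OF bounded_linear_\<phi>_mult(2)])
    then have "((\<lambda>z. \<phi> (d * F z)) has_field_derivative \<phi> (d * D)) (at z)"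
      by (simp add: DERIV_def mult_scaleC_right \<phi>_scaleC right_diff_distrib \<phi>_diff divide_inverse mult.commute)
    then show ?thesis ..
  qed
  then have "(\<lambda>z. \<phi> (d * F z)) holomorphic_on UNIV"
    by (auto simp: holomorphic_on_def field_differentiable_def)
  then have hol: "G holomorphic_on UNIV"
    unfolding G_def by (intro holomorphic_intros)
  have real: "G (of_real r) = 0" for r
  proof -
    have "\<phi> (c * d) = \<phi> (\<sigma> r c * \<sigma> r d)" by (simp only: \<phi>_\<sigma> \<sigma>_mult[symmetric])
    also have "\<dots> = exp (\<i> * of_real r * of_real l) * \<phi> (\<sigma> r c * d)"
      using ab by (simp add: d \<sigma>_monomial l_def mult_scaleC_right \<phi>_scaleC mult.assoc)
    also have "\<phi> (\<sigma> r c * d) = of_real (exp (\<beta> * l)) * \<phi> (d * \<sigma> r c)"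
      using twisted_monomial[OF ab] by (simp add: twisted_def d l_def)
    finally show ?thesis
      using F by (simp add: G_def analytic_extension_def mult.assoc)
  qed
  have lim: "(0::complex) islimpt \<real>"
    unfolding islimpt_approachable
  proof (intro allI impI)
    fix e :: real assume "0 < e"
    then show "\<exists>x\<in>\<real>. x \<noteq> 0 \<and> dist x (0::complex) < e"
      by (intro bexI[of _ "of_real (e / 2)"]) auto
  qed
  have "G (\<i> * of_real \<beta>) = 0"
    by (rule analytic_continuation[OF hol _ _ _ _ lim]) (auto simp: real elim: Reals_cases)
  moreover have "exp (\<i> * (\<i> * of_real \<beta>) * of_real l) * of_real (exp (\<beta> * l)) = (1::complex)"
    by (simp add: mult.assoc[symmetric] exp_of_real[symmetric] exp_add[symmetric])
  ultimately show ?thesis by (simp add: G_def)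
qed

lemma KMS: "KMS_state \<sigma> \<beta> \<phi>"
  unfolding KMS_state_def
proof (intro conjI allI impI state)
  fix c d F assume F: "analytic_extension \<sigma> c F \<and> analytic_element \<sigma> d"
  show "\<phi> (c * d) = \<phi> (d * F (\<i> * complex_of_real \<beta>))"
  proof (rule eq_if_eq_on_monomials[where f = "\<lambda>d. \<phi> (c * d)"])
    fix j k a b assume "0 < (a::nat)" "0 < (b::nat)"
    then show "\<phi> (c * monomial j a b k) = \<phi> (monomial j a b k * F (\<i> * complex_of_real \<beta>))"
      using KMS_monomial[OF conjunct1[OF F]] by blast
  qed (simp_all only: bounded_linear_\<phi>_mult mult_scaleC_left mult_scaleC_right \<phi>_scaleC)
qed

end

theorem theorem4p4:
  fixes W :: "nat \<times> nat \<Rightarrow> 'a::cstar_algebra"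
    and \<sigma> :: "real \<Rightarrow> 'a \<Rightarrow> 'a"
    and \<phi> :: "'a \<Rightarrow> complex"
    and \<beta> :: real
  assumes "universal_covariant_rep W"
    and "dynamics W \<sigma>"
    and "1 \<le> \<beta>"
    and "state \<phi>"
    and "\<And>a b m n x1 x2 y1 y2 :: nat.
      \<lbrakk>0 < a; 0 < b; m \<in> semiP; n \<in> semiP; m = 2 * x1 + 3 * y1; n = 2 * x2 + 3 * y2;
       a \<noteq> b \<or> \<not> [m = n] (mod a)\<rbrakk> \<Longrightarrow>
      \<phi> (gen_s W ^ x1 * gen_t W ^ y1 * gen_v W a * star (gen_v W b)
          * star (gen_t W) ^ y2 * star (gen_s W) ^ x2) = 0"
    and "\<And>a b m n x1 x2 y1 y2 :: nat.
      \<lbrakk>0 < a; 0 < b; m \<in> semiP; n \<in> semiP; m = 2 * x1 + 3 * y1; n = 2 * x2 + 3 * y2;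
       a = b; [m = n] (mod a)\<rbrakk> \<Longrightarrow>
      \<exists>u::int. int a dvd int y1 - int y2 + 2 * u \<and> int a dvd int x1 - int x2 - 3 * u \<and>
        \<phi> (gen_s W ^ x1 * gen_t W ^ y1 * gen_v W a * star (gen_v W b)
            * star (gen_t W) ^ y2 * star (gen_s W) ^ x2)
        = complex_of_real (real a powr (- \<beta>))
          * \<phi> (signed_power (gen_t W) ((int y1 - int y2 + 2 * u) div int a)
                * signed_power (gen_s W) ((int x1 - int x2 - 3 * u) div int a))"
  shows "KMS_state \<sigma> \<beta> \<phi>"
proof -
  interpret generating_rep W
    using assms(1) by unfold_locales (auto simp: universal_covariant_rep_def)
  have formula: "\<phi> (monomial j a b k) = (if a = b \<and> int a dvd j + k
       then complex_of_real (real a powr (- \<beta>)) * \<phi> (U ((j + k) div int a)) else 0)"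
    if ab: "0 < a" "0 < b" for j a b k
  proof -
    obtain x1 y1 x2 y2 :: nat where x: "2 * x1 + 3 * y1 \<noteq> 1" "2 * x2 + 3 * y2 \<noteq> 1"
      and word: "monomial j a b k = s ^ x1 * t ^ y1 * V a * star (V b) * star t ^ y2 * star s ^ x2"
      and jk: "a = b \<Longrightarrow> int (2 * x1 + 3 * y1) - int (2 * x2 + 3 * y2) = j + k"
      using monomial_eq_word[OF ab] by metis
    have P: "2 * x1 + 3 * y1 \<in> semiP" "2 * x2 + 3 * y2 \<in> semiP"
      unfolding in_semiP by (rule x)+
    have cong: "[2 * x1 + 3 * y1 = 2 * x2 + 3 * y2] (mod a) \<longleftrightarrow> int a dvd j + k" if "a = b"
      by (simp only: jk[OF that, symmetric] cong_iff_dvd_diff flip: cong_int_iff)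
    show ?thesis
    proof (cases "a = b \<and> int a dvd j + k")
      case False
      then have "a \<noteq> b \<or> \<not> [2 * x1 + 3 * y1 = 2 * x2 + 3 * y2] (mod a)" using cong by blast
      from assms(5)[OF ab P refl refl this] show ?thesis using False by (simp only: word if_False)
    next
      case True
      then have "[2 * x1 + 3 * y1 = 2 * x2 + 3 * y2] (mod a)" using cong by blast
      from assms(6)[OF ab P refl refl _ this] True obtain u where
        "int a dvd int y1 - int y2 + 2 * u" "int a dvd int x1 - int x2 - 3 * u"
        and \<phi>: "\<phi> (monomial j a b k) = complex_of_real (real a powr (- \<beta>))
          * \<phi> (signed_power t ((int y1 - int y2 + 2 * u) div int a)
                * signed_power s ((int x1 - int x2 - 3 * u) div int a))"
        unfolding word by blast
      then obtain p q where pq: "int y1 - int y2 + 2 * u = int a * p" "int x1 - int x2 - 3 * u = int a * q"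
        by (metis dvdE)
      \<comment> \<open>the integer \<open>u\<close> cancels, so the word on the right is \<open>U\<close> at the quotient whatever \<open>u\<close> is\<close>
      then have "j + k = int a * (3 * p + 2 * q)"
        using jk True by (simp add: algebra_simps)
      then show ?thesis using \<phi> True ab by (simp only: pq signed_word_eq_U) simp
    qed
  qed
  interpret kms_dynamics W \<phi> \<beta> \<sigma>
    by unfold_locales (fact assms(4) formula assms(2))+
  show ?thesis by (rule KMS)
qed

end
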